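(* There exist constants $c,c_1,c_2>0$ such that the following holds. Consider the voter model on $n$ nodes with parameter $A^*$ whose support (number of non-zero entries) has size $s$ and whose non-zero entries are all at least $\alpha>0$, with initial state distribution $\mu$. Let $X$ consist of the observed states of $m$ independent realizations of this process up to their consensus times. Let $$ c_{n,\pi^*}^2=\left(\log\left(\frac{1}{2\pi^*}\right)+\log(2n^3)\right)\log(4n^3), $$ and let $\hat A$ be a minimizer over $A\in\Theta$ of the loss $\mathcal{L}(A;X)=-\ell(A;X)+\lambda_m\|A\|_{1,1}$ with regularization parameter $$ \lambda_m=2\sqrt2\,\frac{c_{n,\pi^*}}{\alpha\sqrt{\Phi_{A^*}}}\sqrt m . $$ Assume that $$ m\ge c_1s^2\,\frac{\log(1/(2\pi^* ))(a+1)\log(n)+(a+1)^2\log(n)^2}{\Phi_{A^*}\,\mathbb{E}^0[\tau]^2\,\lambda_{\min}(\mathbb{E}[X_0X_0^\top])^2},\qquad\text{where } a=sn\,\frac{\log(1/(2\pi^* ))+\log(n)}{(\Phi_{A^*}\mathbb{E}^0[\tau])\,\lambda_{\min}(\mathbb{E}[X_0X_0^\top])}, $$ and $$ m\ge c_2\,n^3\,\frac{1}{\pi^*}\,\frac{1}{(\Phi_{A^*}\mathbb{E}^0[\tau])^2\,\lambda_{\min}(\mathbb{E}[X_0X_0^\top])^2}. $$ Then, with probability at least $1-5/n$, $$ \|\hat A-A^*\|_F^2\le c\,\frac{s\,c_{n,\pi^*}^2}{\alpha^2(\Phi_{A^*}\mathbb{E}^0[\tau])^2\lambda_{\min}(\mathbb{E}[X_0X_0^\top])^2}\,\Phi_{A^*}\frac1m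 . $$
   Context: Voter model: $A^*$ is an $n\times n$ stochastic matrix (non-negative entries, row sums $1$), assumed aperiodic and irreducible; $\pi$ is its unique stationary distribution ($\pi^\top=\pi^\top A^*$) and $\pi^*=\min_v\pi_v$. For a matrix $A$, $a_u^\top$ denotes its $u$-th row. The voter model with parameter $A$ and initial distribution $\mu$ is the Markov chain $\{X_t\}_{t\ge0}$ on $\{0,1\}^n$ with $X_0\sim\mu$ such that, conditionally on $X_t$, the coordinates $X_{t+1,u}$ are independent with $X_{t+1,u}\sim\mathrm{Ber}(a_u^\top X_t)$. With $C=\{\mathbf 0,\mathbf 1\}$, the consensus time is $\tau=\min\{t\ge1:X_t\in C\}$. $\mathbb{E}^0$ is expectation for a voter process with parameter $A^*$ and $X_0\sim\mu$. $\mathbb{E}[X_0X_0^\top]$ (without superscript $0$) is the correlation matrix under the stationary distribution of the extended voter process obtained by concatenating independent voter processes, each started from $\mu$ and run until just before consensus (final consensus states excluded); equivalently $$\mathbb{E}[X_0X_0^\top]=\frac{\mathbb{E}^0\left[\sum_{t=0}^{\tau-1}X_tX_t^\top\right]}{\mathbb{E}^0[\tau]}.$$ $\lambda_{\min}$ denotes the smallest eigenvalue. $\Phi_{A^*}=\min\left\{\frac{\sum_{u=1}^n\pi_u^2V_{a_u^*}(x)}{\pi^\top x(1-\pi^\top x)}: x\in\{0,1\}^n,\ x\notin C\right\}$, where $V_a(x)=a^\top x(1-a^\top x)$. Observations: $X=(X^{(i)}_t)_{0\le t\le\tau_i,\,1\le i\le m}$, with $\{X_t^{(i)}\}$ independent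 voter processes with parameter $A^*$, initial distribution $\mu$, and consensus times $\tau_i$. The log-likelihood is $$\ell(A;X)=\sum_{i=1}^m\left(\log\mu(X_0^{(i)})-\sum_{u=1}^n\sum_{t=0}^{\tau_i-1}H\left(X^{(i)}_{t+1,u},a_u^\top X_t^{(i)}\right)\right),\quad H(p,q)=-(p\log q+(1-p)\log(1-q)),$$ with $0\log0=0$. $\Theta$ is a given set of parameter matrices (the parameter space, containing $A^*$). $\|A\|_{1,1}$ is the sum of absolute values of the entries and $\|\cdot\|_F$ is the Frobenius norm. *)

theory Defs
  imports
    "HOL-Probability.Probability"
    "Jordan_Normal_Form.Char_Poly"
begin

no_notation vec_nth (infixl "$" 90)
hide_const (open) Finite_Cartesian_Product.mat Finite_Cartesian_Product.row
  Finite_Cartesian_Product.vec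

section \<open>Parameter matrices\<close>

definition stochastic_mat :: "nat \<Rightarrow> real mat \<Rightarrow> bool" where
  "stochastic_mat n A \<longleftrightarrow> A \<in> carrier_mat n n
     \<and> (\<forall>u<n. \<forall>v<n. 0 \<le> A $$ (u, v)) \<and> (\<forall>u<n. (\<Sum>v<n. A $$ (u, v)) = 1)"

definition irreducible_mat :: "nat \<Rightarrow> real mat \<Rightarrow> bool" where
  "irreducible_mat n A \<longleftrightarrow> (\<forall>u<n. \<forall>v<n. \<exists>k. 0 < (A ^\<^sub>m k) $$ (u, v))"

definition aperiodic_mat :: "nat \<Rightarrow> real mat \<Rightarrow> bool" where
  "aperiodic_mat n A \<longleftrightarrow> (\<forall>u<n. Gcd {k. 1 \<le> k \<and> 0 < (A ^\<^sub>m k) $$ (u, u)} = 1)"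

definition stationary_vec :: "nat \<Rightarrow> real mat \<Rightarrow> real vec \<Rightarrow> bool" where
  "stationary_vec n A p \<longleftrightarrow> p \<in> carrier_vec n
     \<and> (\<forall>v<n. 0 \<le> p $ v) \<and> (\<Sum>v<n. p $ v) = 1 \<and> transpose_mat A *\<^sub>v p = p"

definition mat_support :: "real mat \<Rightarrow> (nat \<times> nat) set" where
  "mat_support A = {(u, v). u < dim_row A \<and> v < dim_col A \<and> A $$ (u, v) \<noteq> 0}"

definition norm_1_1 :: "real mat \<Rightarrow> real" where
  "norm_1_1 A = (\<Sum>u<dim_row A. \<Sum>v<dim_col A. \<bar>A $$ (u, v)\<bar>)"

definition frobenius_norm :: "real mat \<Rightarrow> real" where
  "frobenius_norm A = sqrt (\<Sum>u<dim_row A. \<Sum>v<dim_col A. (A $$ (u, v))\<^sup>2)"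

text \<open>Only applied to real symmetric matrices of positive dimension, for which the set of
  real eigenvalues is finite and non-empty.\<close>

definition lambda_min :: "real mat \<Rightarrow> real" where
  "lambda_min B = Min {k. eigenvalue B k}"


section \<open>The voter model\<close>

text \<open>An element of \<open>{0,1}\<^sup>n\<close> is a boolean function that is \<^const>\<open>False\<close> outside \<open>{..<n}\<close>
  (nodes are numbered from 0), matching the convention of \<^const>\<open>Pi_pmf\<close>.\<close>

type_synonym state = "nat \<Rightarrow> bool"

definition states :: "nat \<Rightarrow> state set" where
  "states n = {x. \<forall>v\<ge>n. \<not> x v}"

definition consensus :: "nat \<Rightarrow> state set" where
  "consensus n = {\<lambda>_. False, \<lambda>v. v < n}"

definition state_vec :: "nat \<Rightarrow> state \<Rightarrow> real vec" where
  "state_vec n x = Matrix.vec n (\<lambda>v. of_bool (x v))"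

text \<open>\<open>a\<^sub>u\<^sup>T x\<close>, where \<open>a\<^sub>u\<^sup>T\<close> is the \<open>u\<close>-th row of \<open>A\<close>.\<close>

definition row_mean :: "nat \<Rightarrow> real mat \<Rightarrow> nat \<Rightarrow> state \<Rightarrow> real" where
  "row_mean n A u x = scalar_prod (Matrix.row A u) (state_vec n x)"

definition voter_step :: "nat \<Rightarrow> real mat \<Rightarrow> state \<Rightarrow> state pmf" where
  "voter_step n A x = Pi_pmf {..<n} False (\<lambda>u. bernoulli_pmf (row_mean n A u x))"

text \<open>The matrices for which the Bernoulli transition laws above are defined. Every stochastic
  matrix is one of them.\<close>

definition voter_parameter :: "nat \<Rightarrow> real mat \<Rightarrow> bool" where
  "voter_parameter n A \<longleftrightarrow> A \<in> carrier_mat n n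
     \<and> (\<forall>u<n. \<forall>x\<in>states n. 0 \<le> row_mean n A u x \<and> row_mean n A u x \<le> 1)"

definition voter_process ::
    "'w measure \<Rightarrow> nat \<Rightarrow> real mat \<Rightarrow> state pmf \<Rightarrow> (nat \<Rightarrow> 'w \<Rightarrow> state) \<Rightarrow> bool" where
  "voter_process M n A \<mu> X \<longleftrightarrow>
     prob_space M
     \<and> (\<forall>t. X t \<in> measurable M (count_space UNIV))
     \<and> distr M (count_space UNIV) (X 0) = measure_pmf \<mu>
     \<and> (\<forall>t x y. \<P>(\<omega> in M. \<forall>r\<le>t. X r \<omega> = x r) > 0 \<longrightarrow>
          \<P>(\<omega> in M. X (Suc t) \<omega> = y \<bar> \<forall>r\<le>t. X r \<omega> = x r) = pmf (voter_step n A (x t)) y)"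

text \<open>\<open>P\<close> is the law on path space of the voter model with parameter \<open>A\<close> and initial
  distribution \<open>\<mu>\<close>. Working with laws rather than with processes on an arbitrary probability
  space avoids a type variable for the sample space, on which constants quantified inside a
  theorem could otherwise depend.\<close>

definition voter_law :: "nat \<Rightarrow> real mat \<Rightarrow> state pmf \<Rightarrow> (nat \<Rightarrow> state) measure \<Rightarrow> bool" where
  "voter_law n A \<mu> P \<longleftrightarrow>
     sets P = sets (\<Pi>\<^sub>M t\<in>UNIV. count_space UNIV) \<and> voter_process P n A \<mu> (\<lambda>t \<omega>. \<omega> t)"

text \<open>Infinite if consensus is not reached at any time \<open>t \<ge> 1\<close>.\<close>

definition consensus_time :: "nat \<Rightarrow> (nat \<Rightarrow> state) \<Rightarrow> enat" where
  "consensus_time n \<omega> = Inf (enat ` {t. 1 \<le> t \<and> \<omega> t \<in> consensus n})"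

definition expected_consensus_time :: "nat \<Rightarrow> (nat \<Rightarrow> state) measure \<Rightarrow> real" where
  "expected_consensus_time n P = enn2real (\<integral>\<^sup>+\<omega>. ennreal_of_enat (consensus_time n \<omega>) \<partial>P)"

text \<open>Correlation matrix under the stationary distribution of the extended voter process, as the
  normalised expected sum of \<open>X\<^sub>t X\<^sub>t\<^sup>T\<close> over \<open>0 \<le> t < \<tau>\<close>. For the irreducible aperiodic parameters of
  interest \<open>\<tau>\<close> is almost surely finite, so that the default value 0 of the sum over an infinite
  index set is irrelevant; likewise for the log-likelihood below.\<close>

definition correlation_mat :: "nat \<Rightarrow> (nat \<Rightarrow> state) measure \<Rightarrow> real mat" where
  "correlation_mat n P = Matrix.mat n n (\<lambda>(u, v).
     (\<integral>\<omega>. (\<Sum>t | enat t < consensus_time n \<omega>.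
               state_vec n (\<omega> t) $ u * state_vec n (\<omega> t) $ v) \<partial>P)
       / expected_consensus_time n P)"

definition bernoulli_var :: "nat \<Rightarrow> real mat \<Rightarrow> nat \<Rightarrow> state \<Rightarrow> real" where
  "bernoulli_var n A u x = row_mean n A u x * (1 - row_mean n A u x)"

text \<open>Meaningful for \<open>n \<ge> 2\<close>; for smaller \<open>n\<close> every state is a consensus state.\<close>

definition Phi :: "nat \<Rightarrow> real mat \<Rightarrow> real vec \<Rightarrow> real" where
  "Phi n A p = Min ((\<lambda>x. (\<Sum>u<n. (p $ u)\<^sup>2 * bernoulli_var n A u x)
       / (scalar_prod p (state_vec n x) * (1 - scalar_prod p (state_vec n x))))
     ` (states n - consensus n))"


section \<open>Penalised maximum likelihood\<close>

text \<open>The logarithm with \<open>log 0 = -\<infinity>\<close>. Since \<open>0 * \<infinity> = 0\<close> in \<^typ>\<open>ereal\<close>, this gives the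
  convention \<open>0 log 0 = 0\<close>, while a positive mass times \<open>log 0\<close> is \<open>-\<infinity>\<close>.\<close>

definition log_ext :: "real \<Rightarrow> ereal" where
  "log_ext q = (if q \<le> 0 then -\<infinity> else ereal (ln q))"

definition cross_entropy :: "real \<Rightarrow> real \<Rightarrow> ereal" where
  "cross_entropy p q = - (ereal p * log_ext q + ereal (1 - p) * log_ext (1 - q))"

text \<open>\<open>X i\<close> is the \<open>i\<close>-th observed path, \<open>i < m\<close>.\<close>

definition log_likelihood ::
    "nat \<Rightarrow> nat \<Rightarrow> state pmf \<Rightarrow> (nat \<Rightarrow> nat \<Rightarrow> state) \<Rightarrow> real mat \<Rightarrow> ereal" where
  "log_likelihood n m \<mu> X A =
     (\<Sum>i<m. log_ext (pmf \<mu> (X i 0))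
        - (\<Sum>u<n. \<Sum>t | enat t < consensus_time n (X i).
              cross_entropy (of_bool (X i (Suc t) u)) (row_mean n A u (X i t))))"

definition loss ::
    "nat \<Rightarrow> nat \<Rightarrow> state pmf \<Rightarrow> real \<Rightarrow> (nat \<Rightarrow> nat \<Rightarrow> state) \<Rightarrow> real mat \<Rightarrow> ereal" where
  "loss n m \<mu> reg X A = - log_likelihood n m \<mu> X A + ereal (reg * norm_1_1 A)"

end

theory Submission
  imports Defs
begin

text \<open>
  The negative log-likelihood is 1-strongly convex in every conditional mean, so a minimiser of the
  penalised loss satisfies the usual lasso basic inequality, and three facts remain to be shown with
  high probability. With \<open>Y\<^sub>t = \<pi>\<^sup>T X\<^sub>t\<close> the process \<open>Y\<^sub>t (1 - Y\<^sub>t)\<close> contracts by the factor \<open>1 - \<Phi>\<close> per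
  step, which gives the tail \<open>P(\<tau> > t) \<le> exp(-\<Phi> t) / (2 \<pi>\<^sup>*)\<close> and hence a Chernoff bound for the total
  length of the observations. The gradient of the log-likelihood at \<open>A\<^sup>*\<close> is a martingale whose
  increments are sub-Gaussian with parameter \<open>1/\<alpha>\<close>, so it is controlled by the total length through
  an exponential supermartingale. Finally the empirical Gram matrix is close to its mean in
  Frobenius norm by Chebyshev's inequality, because \<open>\<tau>\<close> has a second moment of order
  \<open>1 / (\<pi>\<^sup>* \<Phi>\<^sup>2)\<close>; this turns \<open>\<lambda>\<^sub>m\<^sub>i\<^sub>n\<close> of the correlation matrix into a lower bound for the quadratic term.
\<close>

section \<open>Quadratic forms and the lasso inequality\<close>

text \<open>The number of observed transitions is itself random, which shapes the argument. A
  concentration bound for a fixed sample size does not apply to the gradient, so its exponential is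
  compensated by a multiple of the total length. Where this length is below the deterministic
  threshold K = \<open>m * (log_scale / \<Phi>)\<close>, the compensator is at most its value at K,
  and the free exponent can be tuned to K. The resulting noise level sqrt (2 K L) / \<alpha> with L
  = ln (4 n^3) is half the prescribed regularization parameter, which is the ratio that the lasso
  argument asks for.

  Transition probabilities may be 0 or 1. There the log-loss has no two-sided derivative, and a
  candidate matrix may have infinite loss; hence losses are compared in \<open>ereal\<close>, and
  the gradient is replaced by 0 at such states. At all others the lower bound \<alpha> on the
  entries keeps the probability between \<alpha> and 1 - \<alpha>.\<close>

lemma row_mean_eq:
  assumes "A \<in> carrier_mat n n" "u < n"
  shows "row_mean n A u x = (\<Sum>v<n. A $$ (u, v) * of_bool (x v))"
  using assms by (auto simp: row_mean_def scalar_prod_def state_vec_def lessThan_atLeast0 intro!: sum.cong)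

section \<open>The smallest eigenvalue as a lower bound for quadratic forms\<close>

lemma quadratic_nonneg_imp_linear_coeff_0:
  fixes a b :: real
  assumes "\<And>t. 0 \<le> 2 * t * a + t\<^sup>2 * b"
  shows "a = 0"
proof (rule ccontr)
  assume a: "a \<noteq> 0"
  \<comment> \<open>At t = -a/d the linear term is -2 a^2 / d, and the quadratic term stays below
    a^2 / d because b < d.\<close>
  define d where "d = \<bar>b\<bar> + 1"
  have d: "d > 0" "b < d" by (auto simp: d_def)
  have "2 * (- a / d) * a + (- a / d)\<^sup>2 * b = (a / d)\<^sup>2 * (b - 2 * d)"
    using d by (simp add: field_simps power2_eq_square)
  also have "\<dots> < 0"
    using d a by (intro mult_pos_neg) auto
  finally show False using assms[of "- a / d"] by linarith
qed

text \<open>A minimiser of the quadratic form on the unit sphere exists by compactness and is an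
  eigenvector by the first-order condition. The minimum k is therefore an eigenvalue, hence at least
  \<open>lambda_min B\<close>.\<close>

lemma lambda_min_le_quadratic_form:
  assumes B: "B \<in> carrier_mat n n"
    and sym: "\<And>i j. i < n \<Longrightarrow> j < n \<Longrightarrow> B $$ (i, j) = B $$ (j, i)"
  shows "lambda_min B * (\<Sum>i<n. (x i)\<^sup>2) \<le> (\<Sum>i<n. \<Sum>j<n. x i * B $$ (i, j) * x j)"
proof (cases "n = 0")
  case True
  then show ?thesis by simp
next
  case False
  \<comment> \<open>The sphere is taken inside \<open>nat \<Rightarrow> real\<close> with the
    product topology. With the coordinates from n on pinned to 0 it is a closed part of a box that
    is compact by Tychonoff.\<close>
  define K :: "(nat \<Rightarrow> real) set" where "K = Pi UNIV (\<lambda>i. if i < n then {-1..1} else {0})"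
  define sq :: "(nat \<Rightarrow> real) \<Rightarrow> real" where "sq f = (\<Sum>i<n. (f i)\<^sup>2)" for f
  define q :: "(nat \<Rightarrow> real) \<Rightarrow> real" where
    "q f = (\<Sum>i<n. \<Sum>j<n. f i * B $$ (i, j) * f j)" for f
  have K: "compact K"
  proof -
    have "compactin (product_topology (\<lambda>_. euclidean) UNIV)
            (PiE UNIV (\<lambda>i. if i < n then {-1..1::real} else {0}))"
      by (subst compactin_PiE) auto
    then show ?thesis by (simp add: euclidean_product_topology K_def PiE_def)
  qed
  have coord: "continuous_on S (\<lambda>f. f i)" for S and i :: nat
    by (rule continuous_on_subset[OF continuous_on_product_coordinates]) auto
  have "closed (sq -` {1})"
    unfolding sq_def by (intro closed_vimage) (auto intro!: continuous_intros coord)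
  then have S: "compact (K \<inter> sq -` {1})"
    using K by blast
  have "(\<lambda>i. if i = 0 then 1 else 0) \<in> K \<inter> sq -` {1}"
    using False by (auto simp: K_def sq_def if_distrib[of "\<lambda>x::real. x\<^sup>2"] cong: if_cong)
  then have ne: "K \<inter> sq -` {1} \<noteq> {}" by blast
  have "continuous_on (K \<inter> sq -` {1}) q"
    unfolding q_def by (auto intro!: continuous_intros coord)
  from continuous_attains_inf[OF S ne this] obtain x0 where
    x0: "x0 \<in> K" "sq x0 = 1" and min: "\<And>f. f \<in> K \<Longrightarrow> sq f = 1 \<Longrightarrow> q x0 \<le> q f"
    by auto
  define k where "k = q x0"
  have kle: "k * sq f \<le> q f" for f
  proof (cases "sq f = 0")
    case True
    then have z: "f i = 0" if "i < n" for i
      using that unfolding sq_def by (subst (asm) sum_nonneg_eq_0_iff) auto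
    then show ?thesis by (simp add: sq_def q_def)
  next
    case False
    define r where "r = sqrt (sq f)"
    have r: "r > 0" "r\<^sup>2 = sq f"
      using False by (auto simp: r_def sq_def sum_nonneg order_less_le)
    define g where "g = (\<lambda>i. if i < n then f i / r else 0)"
    have sg: "sq g = 1"
      using r by (simp add: sq_def g_def power_divide flip: sum_divide_distrib) (metis less_irrefl zero_less_power)
    have g1: "- 1 \<le> g i \<and> g i \<le> 1" if "i < n" for i
    proof -
      have "(g i)\<^sup>2 \<le> sq g"
        unfolding sq_def using that by (intro member_le_sum) auto
      then have "\<bar>g i\<bar> \<le> 1" using sg by (simp add: abs_square_le_1)
      then show ?thesis by linarith
    qed
    have "g i = 0" if "\<not> i < n" for i using that by (simp add: g_def)
    with g1 have "g \<in> K" by (auto simp: K_def)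
    from min[OF this sg] have "k \<le> q g" by (simp add: k_def)
    also have "q g = q f / r\<^sup>2"
      unfolding q_def g_def sum_divide_distrib
      by (intro sum.cong refl) (simp add: power2_eq_square)
    finally have "k \<le> q f / r\<^sup>2" .
    then show ?thesis using r by (metis pos_le_divide_eq zero_less_power)
  qed
  define c where "c = (\<lambda>i j. B $$ (i, j) - (if i = j then k else 0))"
  have csym: "c i j = c j i" if "i < n" "j < n" for i j
    using sym that by (simp add: c_def)
  define r where "r = (\<lambda>f::nat \<Rightarrow> real. \<Sum>i<n. \<Sum>j<n. f i * c i j * f j)"
  have r_eq: "r f = q f - k * sq f" for f
  proof -
    have "r f = (\<Sum>i<n. \<Sum>j<n. f i * B $$ (i, j) * f j - (if i = j then k * (f i)\<^sup>2 else 0))"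
      unfolding r_def c_def by (intro sum.cong refl) (auto simp: algebra_simps power2_eq_square)
    then show ?thesis by (simp add: q_def sq_def sum_subtractf sum_distrib_left)
  qed
  \<comment> \<open>g = (B - k I) x0 is half the gradient of \<open>r\<close> at x0. Since r x0 = 0
    and \<open>r\<close> is nonnegative, moving along g forces the linear coefficient
    \<open>sq g\<close> to vanish.\<close>
  define g where "g = (\<lambda>i. \<Sum>j<n. c i j * x0 j)"
  have rt: "r (\<lambda>i. x0 i + t * g i) = 2 * t * sq g + t\<^sup>2 * r g" for t
  proof -
    have a: "(\<Sum>i<n. \<Sum>j<n. g i * c i j * x0 j) = sq g"
      by (simp add: sq_def g_def power2_eq_square sum_distrib_left mult.assoc)
    have "(\<Sum>i<n. \<Sum>j<n. x0 i * c i j * g j) = (\<Sum>i<n. \<Sum>j<n. g i * c i j * x0 j)"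
      by (subst sum.swap) (auto intro!: sum.cong simp: csym)
    with a have b: "(\<Sum>i<n. \<Sum>j<n. x0 i * c i j * g j) = sq g" by simp
    have "r (\<lambda>i. x0 i + t * g i) = r x0 + t * (\<Sum>i<n. \<Sum>j<n. g i * c i j * x0 j)
       + t * (\<Sum>i<n. \<Sum>j<n. x0 i * c i j * g j) + t\<^sup>2 * r g"
      by (simp add: r_def algebra_simps sum.distrib sum_distrib_left power2_eq_square)
    also have "r x0 = 0" by (simp add: r_eq x0 k_def)
    finally show ?thesis by (simp add: a b)
  qed
  have "sq g = 0"
  proof (rule quadratic_nonneg_imp_linear_coeff_0)
    have "0 \<le> r (\<lambda>i. x0 i + t * g i)" for t
      using kle[of "\<lambda>i. x0 i + t * g i"] by (simp add: r_eq)
    then show "0 \<le> 2 * t * sq g + t\<^sup>2 * r g" for t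
      by (simp only: rt)
  qed
  then have g0: "g i = 0" if "i < n" for i
    using that unfolding sq_def by (subst (asm) sum_nonneg_eq_0_iff) auto
  have ev: "(\<Sum>j<n. B $$ (i, j) * x0 j) = k * x0 i" if "i < n" for i
  proof -
    have "g i = (\<Sum>j<n. B $$ (i, j) * x0 j - (if i = j then k * x0 j else 0))"
      unfolding g_def c_def by (intro sum.cong) (auto simp: left_diff_distrib)
    then show ?thesis using g0[OF that] that by (simp add: sum_subtractf)
  qed
  define v where "v = Matrix.vec n x0"
  have "v \<noteq> 0\<^sub>v n"
  proof
    assume "v = 0\<^sub>v n"
    then have "x0 i = 0" if "i < n" for i
      using that by (metis v_def index_vec index_zero_vec(1))
    then show False using x0(2) by (simp add: sq_def)
  qed
  moreover have "B *\<^sub>v v = k \<cdot>\<^sub>v v"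
    using B ev by (intro eq_vecI) (auto simp: v_def scalar_prod_def lessThan_atLeast0)
  ultimately have "eigenvalue B k"
    using B by (auto simp: eigenvalue_def eigenvector_def v_def intro!: exI[of _ "Matrix.vec n x0"])
  moreover have "finite {k. eigenvalue B k}"
  proof -
    have "char_poly B \<noteq> 0"
      using degree_monic_char_poly[OF B] by auto
    then show ?thesis
      using poly_roots_finite by (simp add: eigenvalue_root_char_poly[OF B])
  qed
  ultimately have "lambda_min B \<le> k"
    unfolding lambda_min_def by (intro Min_le) auto
  then have "lambda_min B * sq x \<le> k * sq x"
    by (intro mult_right_mono) (auto simp: sq_def sum_nonneg)
  also have "\<dots> \<le> q x" by (rule kle)
  finally show ?thesis by (simp add: sq_def q_def)
qed

text \<open>For 0 < q < 1 this is the derivative in q of the Bernoulli log-likelihood of the outcome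
  p: 1/q or -1/(1 - q). The value 0 at the end points is a convention.\<close>

definition score :: "real \<Rightarrow> bool \<Rightarrow> real" where
  "score q p = (if 0 < q \<and> q < 1 then (of_bool p - q) / (q * (1 - q)) else 0)"

text \<open>The second derivative 1/r^2 of -ln is at least 1 on (0, 1]. Concretely, the gap
  \<open>g\<close> has derivative (x - q) (1/(x q) - 1), whose second factor is nonnegative as x q
  \<le> 1, so \<open>g\<close> is smallest at q.\<close>

lemma neg_ln_strongly_convex:
  fixes q r :: real
  assumes q: "0 < q" "q \<le> 1" and r: "0 < r" "r \<le> 1"
  shows "- ln q - (r - q) / q + (r - q)\<^sup>2 / 2 \<le> - ln r"
proof -
  define g where "g = (\<lambda>r. - ln r + (r - q) / q - (r - q)\<^sup>2 / 2)"
  have D: "(g has_real_derivative (x - q) * (1 / (x * q) - 1)) (at x)" if "0 < x" for x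
    unfolding g_def using that q
    by (auto intro!: derivative_eq_intros simp: field_simps power2_eq_square)
  have p: "1 / (x * q) - 1 \<ge> 0" if "0 < x" "x \<le> 1" for x
    using that q by (simp add: mult_le_one)
  have "g q \<le> g r"
  proof (cases "q \<le> r")
    case True
    show ?thesis
    proof (rule DERIV_nonneg_imp_nondecreasing[OF True])
      fix x assume x: "q \<le> x" "x \<le> r"
      then show "\<exists>y. (g has_real_derivative y) (at x) \<and> 0 \<le> y"
        using D[of x] p[of x] q r by (intro exI[of _ "(x - q) * (1 / (x * q) - 1)"]) simp
    qed
  next
    case False
    then have "r \<le> q" by simp
    show ?thesis
    proof (rule DERIV_nonpos_imp_nonincreasing[OF \<open>r \<le> q\<close>])
      fix x assume x: "r \<le> x" "x \<le> q"
      then show "\<exists>y. (g has_real_derivative y) (at x) \<and> y \<le> 0"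
        using D[of x] p[of x] q r
        by (intro exI[of _ "(x - q) * (1 / (x * q) - 1)"]) (simp add: mult_nonpos_nonneg)
    qed
  qed
  then show ?thesis by (simp add: g_def)
qed

text \<open>In -ln r \<ge> 1 - r the right-hand side already dominates (1 - r)^2. This is the
  convexity bound at the end point q = 1 with its slope replaced by 0.\<close>

lemma neg_ln_ge_half_square:
  fixes r :: real
  assumes "0 < r" "r \<le> 1"
  shows "(r - 1)\<^sup>2 / 2 \<le> - ln r"
proof -
  have "(1 - r)\<^sup>2 \<le> 1 - r"
    using assms by (simp add: power2_eq_square mult_left_le)
  then show ?thesis using ln_le_minus_one[OF assms(1)] assms by (simp add: power2_commute)
qed

text \<open>The premises exclude an observed outcome of probability zero, which would make the loss
  infinite at the true parameter.\<close>

lemma cross_entropy_self: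
  assumes "0 \<le> q" "q \<le> 1" "q = 0 \<Longrightarrow> \<not> p" "q = 1 \<Longrightarrow> p"
  shows "cross_entropy (of_bool p) q = ereal (- ln (if p then q else 1 - q))"
  using assms by (cases p) (auto simp: cross_entropy_def log_ext_def zero_ereal_def[symmetric])

text \<open>In the degenerate cases \<open>q \<in> {0, 1}\<close> the loss is not differentiable at \<open>q\<close> from both sides,
  but its one-sided slope is favourable, so that the score can be set to zero.\<close>

lemma cross_entropy_ge:
  assumes q: "0 \<le> q" "q \<le> 1" "q = 0 \<Longrightarrow> \<not> p" "q = 1 \<Longrightarrow> p" and r: "0 \<le> r" "r \<le> 1"
  shows "ereal (- ln (if p then q else 1 - q) - score q p * (r - q) + (r - q)\<^sup>2 / 2)
           \<le> cross_entropy (of_bool p) r"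
proof (cases p)
  case True
  show ?thesis
  proof (cases "r = 0")
    case True
    then show ?thesis using \<open>p\<close> by (simp add: cross_entropy_def log_ext_def zero_ereal_def[symmetric])
  next
    case False
    have "0 < q" using q True by (cases "q = 0") auto
    have "- ln q - score q p * (r - q) + (r - q)\<^sup>2 / 2 \<le> - ln r"
    proof (cases "q = 1")
      case True
      then show ?thesis using neg_ln_ge_half_square[of r] False r by (simp add: score_def)
    next
      case False
      then have "score q p = 1 / q"
        using \<open>0 < q\<close> q \<open>p\<close> by (simp add: score_def)
      then show ?thesis using neg_ln_strongly_convex[of q r] \<open>r \<noteq> 0\<close> r \<open>0 < q\<close> q by simp
    qed
    then show ?thesis using \<open>p\<close> False r
      by (simp add: cross_entropy_def log_ext_def zero_ereal_def[symmetric])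
  qed
next
  case np: False
  show ?thesis
  proof (cases "r = 1")
    case True
    then show ?thesis using np by (simp add: cross_entropy_def log_ext_def zero_ereal_def[symmetric])
  next
    case False
    have "q < 1" using q np by (cases "q = 1") auto
    \<comment> \<open>The outcome False is the outcome True for the probabilities 1 - q and 1 - r,
      at the same squared distance.\<close>
    have sq: "(r - q)\<^sup>2 = (1 - r - (1 - q))\<^sup>2" by (simp add: power2_commute)
    have "- ln (1 - q) - score q p * (r - q) + (r - q)\<^sup>2 / 2 \<le> - ln (1 - r)"
    proof (cases "q = 0")
      case True
      then show ?thesis using neg_ln_ge_half_square[of "1 - r"] False r by (simp add: score_def)
    next
      case False
      then have "score q p = - 1 / (1 - q)"
        using \<open>q < 1\<close> q np by (simp add: score_def)
      moreover have "(1 - r - (1 - q)) / (1 - q) = - (r - q) / (1 - q)" by simp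
      ultimately show ?thesis
        using neg_ln_strongly_convex[of "1 - q" "1 - r"] \<open>r \<noteq> 1\<close> r \<open>q < 1\<close> q unfolding sq
        by (simp add: diff_divide_distrib)
    qed
    then show ?thesis using np False r
      by (simp add: cross_entropy_def log_ext_def zero_ereal_def[symmetric])
  qed
qed

text \<open>Noise of at most half the penalty leaves only the entries of b - a on the support S of
  a. Cauchy-Schwarz bounds their l1-norm by sqrt (F * card S), and solving \<kappa>/2 * F \<le> 3/2
  * reg * sqrt (F * card S) for F gives the factor 9.\<close>

lemma lasso_bound:
  fixes a b g :: "nat \<Rightarrow> nat \<Rightarrow> real" and n :: nat
  defines "F \<equiv> (\<Sum>u<n. \<Sum>v<n. (b u v - a u v)\<^sup>2)"
  assumes basic: "\<kappa> / 2 * F - (\<Sum>u<n. \<Sum>v<n. g u v * (b u v - a u v))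
      + reg * ((\<Sum>u<n. \<Sum>v<n. \<bar>b u v\<bar>) - (\<Sum>u<n. \<Sum>v<n. \<bar>a u v\<bar>)) \<le> 0"
    and g: "\<And>u v. u < n \<Longrightarrow> v < n \<Longrightarrow> \<bar>g u v\<bar> \<le> reg / 2"
    and pos: "0 < \<kappa>" "0 \<le> reg"
  shows "F \<le> 9 * reg\<^sup>2 * real (card {(u, v). u < n \<and> v < n \<and> a u v \<noteq> 0}) / \<kappa>\<^sup>2"
proof -
  define S where "S = {(u, v). u < n \<and> v < n \<and> a u v \<noteq> 0}"
  have fS: "finite S" by (rule finite_subset[of _ "{..<n} \<times> {..<n}"]) (auto simp: S_def)
  have F0: "F \<ge> 0" unfolding F_def by (intro sum_nonneg) auto
  define d where "d = (\<lambda>u v. b u v - a u v)"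
  have "\<kappa> / 2 * F \<le> (\<Sum>u<n. \<Sum>v<n. g u v * d u v)
      + reg * ((\<Sum>u<n. \<Sum>v<n. \<bar>a u v\<bar>) - (\<Sum>u<n. \<Sum>v<n. \<bar>b u v\<bar>))"
    using basic by (simp add: d_def algebra_simps)
  also have "\<dots> = (\<Sum>u<n. \<Sum>v<n. g u v * d u v + reg * (\<bar>a u v\<bar> - \<bar>b u v\<bar>))"
    by (simp add: sum.distrib sum_subtractf right_diff_distrib sum_distrib_left)
  also have "\<dots> \<le> (\<Sum>u<n. \<Sum>v<n. 3 / 2 * reg * (if (u, v) \<in> S then \<bar>d u v\<bar> else 0))"
  proof (intro sum_mono)
    fix u v assume "u \<in> {..<n}" "v \<in> {..<n}"
    then have uv: "u < n" "v < n" by auto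
    have "g u v * d u v \<le> \<bar>g u v\<bar> * \<bar>d u v\<bar>"
      by (metis abs_ge_self abs_mult)
    also have "\<dots> \<le> reg / 2 * \<bar>d u v\<bar>"
      using g[OF uv] by (intro mult_right_mono) auto
    finally have 1: "g u v * d u v \<le> reg / 2 * \<bar>d u v\<bar>" .
    \<comment> \<open>On S the penalty can drop by at most reg |d|, which adds to the noise reg/2
      |d|. Off S the entry of a is 0, so the penalty grows by reg |d| and absorbs the noise.\<close>
    show "g u v * d u v + reg * (\<bar>a u v\<bar> - \<bar>b u v\<bar>)
        \<le> 3 / 2 * reg * (if (u, v) \<in> S then \<bar>d u v\<bar> else 0)"
    proof (cases "(u, v) \<in> S")
      case True
      have "reg * (\<bar>a u v\<bar> - \<bar>b u v\<bar>) \<le> reg * \<bar>d u v\<bar>"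
        using pos by (intro mult_left_mono) (auto simp: d_def)
      with 1 True show ?thesis by simp
    next
      case False
      then have "a u v = 0" using uv by (auto simp: S_def)
      moreover have "0 \<le> reg * \<bar>b u v\<bar>" using pos by simp
      ultimately show ?thesis using 1 False by (simp add: d_def)
    qed
  qed
  also have "\<dots> = 3 / 2 * reg * (\<Sum>p\<in>{..<n} \<times> {..<n}. if p \<in> S then \<bar>d (fst p) (snd p)\<bar> else 0)"
    by (simp add: sum_distrib_left sum.cartesian_product case_prod_unfold)
  also have "(\<Sum>p\<in>{..<n} \<times> {..<n}. if p \<in> S then \<bar>d (fst p) (snd p)\<bar> else 0)
      = (\<Sum>p\<in>S. \<bar>d (fst p) (snd p)\<bar>)"
    by (subst sum.inter_restrict[symmetric]) (auto simp: S_def intro!: sum.cong)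
  finally have 2: "\<kappa> / 2 * F \<le> 3 / 2 * reg * (\<Sum>p\<in>S. \<bar>d (fst p) (snd p)\<bar>)" .
  have "(\<Sum>p\<in>S. \<bar>d (fst p) (snd p)\<bar>)\<^sup>2 \<le> (\<Sum>p\<in>S. \<bar>d (fst p) (snd p)\<bar>\<^sup>2) * real (card S)"
    using Cauchy_Schwarz_ineq_sum[of "\<lambda>p. \<bar>d (fst p) (snd p)\<bar>" "\<lambda>_. 1" S] by simp
  also have "(\<Sum>p\<in>S. \<bar>d (fst p) (snd p)\<bar>\<^sup>2) \<le> (\<Sum>p\<in>{..<n} \<times> {..<n}. \<bar>d (fst p) (snd p)\<bar>\<^sup>2)"
    by (intro sum_mono2) (auto simp: S_def)
  also have "\<dots> = F"
    by (simp add: F_def d_def sum.cartesian_product case_prod_unfold)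
  finally have 3: "(\<Sum>p\<in>S. \<bar>d (fst p) (snd p)\<bar>)\<^sup>2 \<le> F * real (card S)"
    by (simp add: mult_right_mono)
  have "(\<kappa> * F)\<^sup>2 \<le> (3 * reg * (\<Sum>p\<in>S. \<bar>d (fst p) (snd p)\<bar>))\<^sup>2"
    using 2 pos F0 by (intro power_mono) auto
  also have "\<dots> \<le> 9 * reg\<^sup>2 * (F * real (card S))"
    using 3 by (simp add: power_mult_distrib mult_left_mono)
  finally have "F * (\<kappa>\<^sup>2 * F) \<le> F * (9 * reg\<^sup>2 * real (card S))"
    by (simp add: power2_eq_square algebra_simps)
  then have "\<kappa>\<^sup>2 * F \<le> 9 * reg\<^sup>2 * real (card S)" if "F \<noteq> 0"
    using that F0 by (simp add: mult_le_cancel_left)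
  then have "\<kappa>\<^sup>2 * F \<le> 9 * reg\<^sup>2 * real (card S)"
    by (cases "F = 0") auto
  then show ?thesis using pos by (simp add: S_def[symmetric] pos_le_divide_eq mult.commute)
qed

text \<open>Almost sure properties of a path under which the loss at the true parameter is finite.
  Given them, the comparison of losses is deterministic.\<close>

definition admissible_path :: "nat \<Rightarrow> real mat \<Rightarrow> state pmf \<Rightarrow> (nat \<Rightarrow> state) \<Rightarrow> bool" where
  "admissible_path n A \<mu> \<omega> \<longleftrightarrow> pmf \<mu> (\<omega> 0) > 0 \<and> (\<forall>t. \<omega> t \<in> states n) \<and>
     (\<forall>t. \<forall>u<n. (row_mean n A u (\<omega> t) = 0 \<longrightarrow> \<not> \<omega> (Suc t) u) \<and>
                (row_mean n A u (\<omega> t) = 1 \<longrightarrow> \<omega> (Suc t) u))"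

lemma stochastic_imp_voter_parameter:
  assumes "stochastic_mat n A"
  shows "voter_parameter n A"
  unfolding voter_parameter_def
proof (intro conjI allI impI ballI)
  show A: "A \<in> carrier_mat n n" using assms by (simp add: stochastic_mat_def)
  fix u x assume u: "u < n"
  show "0 \<le> row_mean n A u x"
    using assms u unfolding row_mean_eq[OF A u] stochastic_mat_def by (intro sum_nonneg) auto
  have "row_mean n A u x \<le> (\<Sum>v<n. A $$ (u, v))"
    using assms u unfolding row_mean_eq[OF A u] stochastic_mat_def by (intro sum_mono) auto
  then show "row_mean n A u x \<le> 1"
    using assms u by (simp add: stochastic_mat_def)
qed

text \<open>On admissible paths the loss at A is a real number, while the loss at Ah may be
  infinite. Replacing the latter by its quadratic minorant from \<open>cross_entropy_ge\<close>
  turns minimality into an inequality between reals. For a path without consensus the sums over t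
  have an infinite index set and are 0 on all sides.\<close>

lemma loss_basic_inequality:
  assumes A: "voter_parameter n A" and Ah: "voter_parameter n Ah"
    and adm: "\<And>i. i < m \<Longrightarrow> admissible_path n A \<mu> (X i)"
    and min: "\<not> loss n m \<mu> reg X A < loss n m \<mu> reg X Ah"
  defines "\<Delta> \<equiv> \<lambda>i u t. row_mean n Ah u (X i t) - row_mean n A u (X i t)"
  shows "(\<Sum>i<m. \<Sum>u<n. \<Sum>t | enat t < consensus_time n (X i).
             (\<Delta> i u t)\<^sup>2 / 2 - score (row_mean n A u (X i t)) (X i (Suc t) u) * \<Delta> i u t)
           + reg * (norm_1_1 Ah - norm_1_1 A) \<le> 0"
proof -
  let ?I = "\<lambda>i. {t. enat t < consensus_time n (X i)}"
  let ?q = "\<lambda>i u t. row_mean n A u (X i t)"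
  let ?p = "\<lambda>i u t. X i (Suc t) u"
  let ?h = "\<lambda>i u t. - ln (if ?p i u t then ?q i u t else 1 - ?q i u t)"
  let ?e = "\<lambda>i u t. (\<Delta> i u t)\<^sup>2 / 2 - score (?q i u t) (?p i u t) * \<Delta> i u t"
  define L where "L = (\<Sum>i<m. ln (pmf \<mu> (X i 0)) - (\<Sum>u<n. \<Sum>t\<in>?I i. ?h i u t))"
  define L' where "L' = (\<Sum>i<m. ln (pmf \<mu> (X i 0)) - (\<Sum>u<n. \<Sum>t\<in>?I i. ?h i u t + ?e i u t))"
  have init: "log_ext (pmf \<mu> (X i 0)) = ereal (ln (pmf \<mu> (X i 0)))" if "i < m" for i
    using adm[OF that] by (simp add: admissible_path_def log_ext_def)
  have q: "0 \<le> ?q i u t" "?q i u t \<le> 1" "?q i u t = 0 \<Longrightarrow> \<not> ?p i u t" "?q i u t = 1 \<Longrightarrow> ?p i u t"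
    and r: "0 \<le> row_mean n Ah u (X i t)" "row_mean n Ah u (X i t) \<le> 1"
    if "i < m" "u < n" for i u t
    using A Ah adm[OF that(1)] that(2) unfolding voter_parameter_def admissible_path_def by auto
  have "log_likelihood n m \<mu> X A = (\<Sum>i<m. ereal (ln (pmf \<mu> (X i 0)))
      - (\<Sum>u<n. \<Sum>t\<in>?I i. ereal (?h i u t)))"
    unfolding log_likelihood_def
    by (intro sum.cong refl arg_cong2[where f = minus] init cross_entropy_self q) auto
  also have "\<dots> = ereal L"
    by (simp add: L_def)
  finally have 1: "loss n m \<mu> reg X A = ereal (- L + reg * norm_1_1 A)"
    by (simp add: loss_def)
  have "log_likelihood n m \<mu> X Ah \<le> (\<Sum>i<m. ereal (ln (pmf \<mu> (X i 0)))
      - (\<Sum>u<n. \<Sum>t\<in>?I i. ereal (?h i u t + ?e i u t)))"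
    unfolding log_likelihood_def
  proof (intro sum_mono ereal_minus_mono)
    fix i u t assume "i \<in> {..<m}" "u \<in> {..<n}"
    then have iu: "i < m" "u < n" by auto
    show "ereal (?h i u t + ?e i u t) \<le> cross_entropy (of_bool (?p i u t)) (row_mean n Ah u (X i t))"
      using cross_entropy_ge[OF q[OF iu] r[OF iu], of t t] by (simp add: \<Delta>_def algebra_simps)
  qed (simp add: init)
  also have "\<dots> = ereal L'"
    by (simp add: L'_def)
  finally have "- ereal L' + ereal (reg * norm_1_1 Ah) \<le> loss n m \<mu> reg X Ah"
    unfolding loss_def by (intro add_right_mono) (simp only: ereal_minus_le_minus)
  with 1 min have "- L' + reg * norm_1_1 Ah \<le> - L + reg * norm_1_1 A"
    by (metis ereal_less_eq(3) linorder_not_less order_trans plus_ereal.simps(1) uminus_ereal.simps(1))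
  moreover have "L - L' = (\<Sum>i<m. \<Sum>u<n. \<Sum>t\<in>?I i. ?e i u t)"
    by (simp add: L_def L'_def sum.distrib sum_subtractf sum_negf algebra_simps)
  ultimately show ?thesis by (simp add: algebra_simps)
qed

section \<open>Paths of the voter model\<close>

lemma finite_states [simp]: "finite (states n)"
proof -
  have "states n \<subseteq> (\<lambda>S v. v \<in> S) ` Pow {..<n}"
  proof
    fix x assume "x \<in> states n"
    then have "x = (\<lambda>v. v \<in> {v. x v})" "{v. x v} \<in> Pow {..<n}"
      by (auto simp: states_def not_less[symmetric])
    then show "x \<in> (\<lambda>S v. v \<in> S) ` Pow {..<n}" by blast
  qed
  then show ?thesis by (rule finite_subset) simp
qed

lemma set_voter_step:
  assumes "y \<in> set_pmf (voter_step n A x)"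
  shows "y \<in> states n"
    and "u < n \<Longrightarrow> row_mean n A u x = 0 \<Longrightarrow> \<not> y u"
    and "u < n \<Longrightarrow> row_mean n A u x = 1 \<Longrightarrow> y u"
proof -
  have y: "y \<in> PiE_dflt {..<n} False (set_pmf \<circ> (\<lambda>u. bernoulli_pmf (row_mean n A u x)))"
    using assms by (simp add: voter_step_def set_Pi_pmf)
  then show "y \<in> states n"
    by (auto simp: PiE_dflt_def states_def)
  show "\<not> y u" if "u < n" "row_mean n A u x = 0"
  proof -
    have "y u \<in> set_pmf (bernoulli_pmf 0)"
      using y that by (auto simp: PiE_dflt_def)
    then show ?thesis by (cases "y u") (auto simp: set_pmf_iff)
  qed
  show "y u" if "u < n" "row_mean n A u x = 1"
  proof -
    have "y u \<in> set_pmf (bernoulli_pmf 1)"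
      using y that by (auto simp: PiE_dflt_def)
    then show ?thesis by (cases "y u") (auto simp: set_pmf_iff)
  qed
qed

locale voter_chain = prob_space P for P :: "(nat \<Rightarrow> state) measure" +
  fixes n :: nat and A :: "real mat" and \<mu> :: "state pmf"
  assumes sets_P: "sets P = sets (\<Pi>\<^sub>M t\<in>UNIV. count_space UNIV)"
    and law0: "distr P (count_space UNIV) (\<lambda>\<omega>. \<omega> 0) = measure_pmf \<mu>"
    and law_Suc: "\<P>(\<omega> in P. \<forall>r\<le>t. \<omega> r = x r) > 0 \<Longrightarrow>
          \<P>(\<omega> in P. \<omega> (Suc t) = y \<bar> \<forall>r\<le>t. \<omega> r = x r) = pmf (voter_step n A (x t)) y"
    and init: "set_pmf \<mu> \<subseteq> states n"
    and stoch: "stochastic_mat n A"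
begin

section \<open>Conditioning on finite histories\<close>

lemma space_P [simp]: "space P = UNIV"
  using sets_eq_imp_space_eq[OF sets_P] by (simp add: space_PiM)

lemma measurable_component [measurable]: "(\<lambda>\<omega>. \<omega> t) \<in> measurable P (count_space UNIV)"
  unfolding measurable_cong_sets[OF sets_P refl] by measurable

lemma component_set: "Measurable.pred P (\<lambda>\<omega>. Q (\<omega> t))"
  by (rule measurable_compose[OF measurable_component]) simp

lemma component_fun:
  fixes f :: "state \<Rightarrow> 'b :: topological_space"
  shows "(\<lambda>\<omega>. f (\<omega> t)) \<in> borel_measurable P"
  by (rule measurable_compose[OF measurable_component]) simp

lemma history_set [measurable]: "{\<omega>. \<forall>r\<le>t. \<omega> r = x r} \<in> sets P"
proof -
  have "Measurable.pred P (\<lambda>\<omega>. \<forall>r\<le>t. \<omega> r = x r)" by measurable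
  then show ?thesis by (simp add: pred_def)
qed

lemma history_Suc_set [measurable]: "{\<omega>. (\<forall>r\<le>t. \<omega> r = x r) \<and> Q (\<omega> (Suc t))} \<in> sets P"
proof -
  note component_set[of Q "Suc t", measurable]
  have "Measurable.pred P (\<lambda>\<omega>. (\<forall>r\<le>t. \<omega> r = x r) \<and> Q (\<omega> (Suc t)))" by measurable
  then show ?thesis by (simp add: pred_def)
qed

text \<open>Clearing the denominator of the conditional probability also covers histories of
  probability zero, for which both sides vanish.\<close>

lemma emeasure_Suc:
  "emeasure P {\<omega>. (\<forall>r\<le>t. \<omega> r = x r) \<and> \<omega> (Suc t) = y}
     = ennreal (pmf (voter_step n A (x t)) y) * emeasure P {\<omega>. \<forall>r\<le>t. \<omega> r = x r}"
proof (cases "\<P>(\<omega> in P. \<forall>r\<le>t. \<omega> r = x r) > 0")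
  case True
  have "measure P {\<omega>. (\<forall>r\<le>t. \<omega> r = x r) \<and> \<omega> (Suc t) = y}
     = pmf (voter_step n A (x t)) y * measure P {\<omega>. \<forall>r\<le>t. \<omega> r = x r}"
    using law_Suc[OF True, of y] True by (simp add: cond_prob_def field_simps conj_commute)
  then show ?thesis
    by (simp add: emeasure_eq_measure ennreal_mult)
next
  case False
  then have 0: "emeasure P {\<omega>. \<forall>r\<le>t. \<omega> r = x r} = 0"
    by (simp add: emeasure_eq_measure zero_less_measure_iff)
  have "emeasure P {\<omega>. (\<forall>r\<le>t. \<omega> r = x r) \<and> \<omega> (Suc t) = y} \<le> emeasure P {\<omega>. \<forall>r\<le>t. \<omega> r = x r}"
    using history_set by (intro emeasure_mono) auto
  then show ?thesis using 0 by simp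
qed

text \<open>The type \<open>state\<close> is uncountable. Restricting to \<open>states n\<close> and
  padding with a fixed state after time t leaves finitely many functions, so that integrals over the
  past become finite sums.\<close>

definition histories :: "nat \<Rightarrow> (nat \<Rightarrow> state) set" where
  "histories t = {h. (\<forall>r\<le>t. h r \<in> states n) \<and> (\<forall>r>t. h r = (\<lambda>_. False))}"

definition cut :: "nat \<Rightarrow> (nat \<Rightarrow> state) \<Rightarrow> nat \<Rightarrow> state" where
  "cut t \<omega> = (\<lambda>r. if r \<le> t then \<omega> r else (\<lambda>_. False))"

lemma finite_histories [simp]: "finite (histories t)"
proof -
  have "histories t = PiE_dflt {..t} (\<lambda>_. False) (\<lambda>_. states n)"
    by (auto simp: histories_def PiE_dflt_def not_le)
  then show ?thesis by (simp add: finite_PiE_dflt)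
qed

lemma cut_in_histories: "\<forall>r\<le>t. \<omega> r \<in> states n \<Longrightarrow> cut t \<omega> \<in> histories t"
  by (auto simp: histories_def cut_def)

lemma history_eq_iff: "h \<in> histories t \<Longrightarrow> (\<forall>r\<le>t. \<omega> r = h r) \<longleftrightarrow> h = cut t \<omega>"
  by (fastforce simp: histories_def cut_def fun_eq_iff not_le)

lemma finite_set_voter_step [simp]: "finite (set_pmf (voter_step n A x))"
  by (rule finite_subset[OF _ finite_states[of n]]) (auto dest: set_voter_step)

text \<open>For each fixed history the finitely many possible successors have total conditional mass
  1, so leaving them is a null event. Finitely many histories suffice; the impossible successors
  themselves are uncountably many and cannot be discarded one at a time.\<close>

lemma AE_step_support:
  assumes "AE \<omega> in P. \<forall>r\<le>t. \<omega> r \<in> states n"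
  shows "AE \<omega> in P. \<omega> (Suc t) \<in> set_pmf (voter_step n A (\<omega> t))"
proof -
  have "AE \<omega> in P. (\<forall>r\<le>t. \<omega> r = h r) \<longrightarrow> \<omega> (Suc t) \<in> set_pmf (voter_step n A (h t))" for h
  proof -
    define S where "S = set_pmf (voter_step n A (h t))"
    let ?E = "\<lambda>Q. {\<omega>. (\<forall>r\<le>t. \<omega> r = h r) \<and> Q (\<omega> (Suc t))}"
    have "emeasure P (?E (\<lambda>y. y \<in> S)) = (\<Sum>y\<in>S. emeasure P (?E (\<lambda>z. z = y)))"
      by (subst sum_emeasure) (auto simp: S_def disjoint_family_on_def intro!: arg_cong[where f = "emeasure P"])
    also have "\<dots> = (\<Sum>y\<in>S. ennreal (pmf (voter_step n A (h t)) y)) * emeasure P {\<omega>. \<forall>r\<le>t. \<omega> r = h r}"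
      by (simp only: emeasure_Suc sum_distrib_right)
    also have "(\<Sum>y\<in>S. ennreal (pmf (voter_step n A (h t)) y)) = 1"
      by (subst sum_ennreal) (auto simp: S_def sum_pmf_eq_1)
    finally have "prob (?E (\<lambda>y. y \<in> S)) = prob {\<omega>. \<forall>r\<le>t. \<omega> r = h r}"
      by (simp add: measure_def)
    moreover have "?E (\<lambda>y. y \<notin> S) = {\<omega>. \<forall>r\<le>t. \<omega> r = h r} - ?E (\<lambda>y. y \<in> S)"
      by auto
    ultimately have "prob (?E (\<lambda>y. y \<notin> S)) = 0"
      by (simp only:) (subst finite_measure_Diff, auto)
    then show ?thesis
      by (intro AE_I[where N = "?E (\<lambda>y. y \<notin> S)"]) (auto simp: S_def emeasure_eq_measure)
  qed
  then have "AE \<omega> in P. \<forall>h\<in>histories t. (\<forall>r\<le>t. \<omega> r = h r) \<longrightarrow> \<omega> (Suc t) \<in> set_pmf (voter_step n A (h t))"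
    by (intro AE_finite_allI) auto
  with assms show ?thesis
  proof eventually_elim
    case (elim \<omega>)
    from elim(2) cut_in_histories[OF elim(1)] show ?case by (auto simp: cut_def)
  qed
qed

lemma AE_states: "AE \<omega> in P. \<forall>t. \<omega> t \<in> states n"
proof -
  have "AE \<omega> in P. \<forall>r\<le>t. \<omega> r \<in> states n" for t
  proof (induction t)
    case 0
    have "AE x in distr P (count_space UNIV) (\<lambda>\<omega>. \<omega> 0). x \<in> states n"
      unfolding law0 using init by (auto simp: AE_measure_pmf_iff)
    from AE_distrD[OF measurable_component this] show ?case by simp
  next
    case (Suc t)
    from Suc AE_step_support[OF Suc] show ?case
      by eventually_elim (auto simp: le_Suc_eq dest: set_voter_step)
  qed
  then have "AE \<omega> in P. \<forall>t. \<forall>r\<le>t. \<omega> r \<in> states n"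
    by (simp add: AE_all_countable)
  then show ?thesis by eventually_elim auto
qed

lemma AE_admissible: "AE \<omega> in P. admissible_path n A \<mu> \<omega>"
proof -
  have "AE x in distr P (count_space UNIV) (\<lambda>\<omega>. \<omega> 0). pmf \<mu> x > 0"
    unfolding law0 by (auto simp: AE_measure_pmf_iff pmf_positive)
  from AE_distrD[OF measurable_component this] have 1: "AE \<omega> in P. pmf \<mu> (\<omega> 0) > 0" .
  have "AE \<omega> in P. \<omega> (Suc t) \<in> set_pmf (voter_step n A (\<omega> t))" for t
    by (rule AE_step_support) (use AE_states in eventually_elim, auto)
  then have "AE \<omega> in P. \<forall>t. \<omega> (Suc t) \<in> set_pmf (voter_step n A (\<omega> t))"
    by (simp add: AE_all_countable)
  with 1 AE_states show ?thesis
    by eventually_elim (auto simp: admissible_path_def dest: set_voter_step)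
qed

text \<open>No measurability of \<open>G\<close> is required: almost every path stays in the finite state space, where
  the integrand agrees with a simple function.\<close>

lemma nn_integral_Suc:
  fixes G :: "(nat \<Rightarrow> state) \<Rightarrow> state \<Rightarrow> ennreal"
  assumes dep: "\<And>\<omega> \<omega>' y. (\<And>r. r \<le> t \<Longrightarrow> \<omega> r = \<omega>' r) \<Longrightarrow> G \<omega> y = G \<omega>' y"
  shows "(\<integral>\<^sup>+\<omega>. G \<omega> (\<omega> (Suc t)) \<partial>P)
           = (\<integral>\<^sup>+\<omega>. (\<integral>\<^sup>+y. G \<omega> y \<partial>measure_pmf (voter_step n A (\<omega> t))) \<partial>P)"
proof -
  let ?h = "\<lambda>h. {\<omega>. \<forall>r\<le>t. \<omega> r = h r}"
  let ?hy = "\<lambda>h y. {\<omega>. (\<forall>r\<le>t. \<omega> r = h r) \<and> \<omega> (Suc t) = y}"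
  have G_cut: "G (cut t \<omega>) = G \<omega>" for \<omega>
    by (rule ext, rule dep) (simp add: cut_def)
  have cut_t: "cut t \<omega> t = \<omega> t" for \<omega>
    by (simp add: cut_def)
  have "(\<integral>\<^sup>+\<omega>. G \<omega> (\<omega> (Suc t)) \<partial>P)
      = (\<integral>\<^sup>+\<omega>. (\<Sum>h\<in>histories t. \<Sum>y\<in>states n. G h y * indicator (?hy h y) \<omega>) \<partial>P)"
  proof (rule nn_integral_cong_AE)
    from AE_states show "AE \<omega> in P. G \<omega> (\<omega> (Suc t))
        = (\<Sum>h\<in>histories t. \<Sum>y\<in>states n. G h y * indicator (?hy h y) \<omega>)"
    proof eventually_elim
      case (elim \<omega>)
      have "(\<Sum>h\<in>histories t. \<Sum>y\<in>states n. G h y * indicator (?hy h y) \<omega>)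
          = (\<Sum>h\<in>histories t. \<Sum>y\<in>states n. if h = cut t \<omega> then if y = \<omega> (Suc t) then G h y else 0 else 0)"
        by (intro sum.cong refl) (auto simp: history_eq_iff indicator_def)
      also have "\<dots> = G (cut t \<omega>) (\<omega> (Suc t))"
        using elim cut_in_histories[of t \<omega>]
        by (subst sum.swap) (simp add: sum.delta cong: if_cong)
      finally show ?case by (simp add: G_cut)
    qed
  qed
  also have "\<dots> = (\<Sum>h\<in>histories t. \<Sum>y\<in>states n. G h y * emeasure P (?hy h y))"
    by (simp add: nn_integral_sum nn_integral_cmult del: sum_mult_indicator)
  also have "\<dots> = (\<Sum>h\<in>histories t. (\<integral>\<^sup>+y. G h y \<partial>measure_pmf (voter_step n A (h t))) * emeasure P (?h h))"
    by (subst nn_integral_measure_pmf_support[OF finite_states[of n]])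
       (auto simp: emeasure_Suc sum_distrib_right mult.assoc dest: set_voter_step)
  also have "\<dots> = (\<integral>\<^sup>+\<omega>. (\<Sum>h\<in>histories t. (\<integral>\<^sup>+y. G h y \<partial>measure_pmf (voter_step n A (h t))) * indicator (?h h) \<omega>) \<partial>P)"
    by (simp add: nn_integral_sum nn_integral_cmult del: sum_mult_indicator)
  also have "\<dots> = (\<integral>\<^sup>+\<omega>. (\<integral>\<^sup>+y. G \<omega> y \<partial>measure_pmf (voter_step n A (\<omega> t))) \<partial>P)"
  proof (rule nn_integral_cong_AE)
    from AE_states show "AE \<omega> in P.
        (\<Sum>h\<in>histories t. (\<integral>\<^sup>+y. G h y \<partial>measure_pmf (voter_step n A (h t))) * indicator (?h h) \<omega>)
        = (\<integral>\<^sup>+y. G \<omega> y \<partial>measure_pmf (voter_step n A (\<omega> t)))"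
    proof eventually_elim
      case (elim \<omega>)
      have "(\<Sum>h\<in>histories t. (\<integral>\<^sup>+y. G h y \<partial>measure_pmf (voter_step n A (h t))) * indicator (?h h) \<omega>)
          = (\<Sum>h\<in>histories t. if h = cut t \<omega> then \<integral>\<^sup>+y. G h y \<partial>measure_pmf (voter_step n A (h t)) else 0)"
        by (intro sum.cong refl) (auto simp: history_eq_iff indicator_def)
      also have "\<dots> = (\<integral>\<^sup>+y. G \<omega> y \<partial>measure_pmf (voter_step n A (\<omega> t)))"
        using elim cut_in_histories[of t \<omega>] by (simp add: G_cut cut_t)
      finally show ?case .
    qed
  qed
  finally show ?thesis .
qed

end

section \<open>Contraction of the disagreement\<close>

text \<open>Stationarity passes on to every power of A. Some p_v is positive because the entries sum
  to 1, and irreducibility provides a power with positive entry (v, u), which carries mass from v to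
  u.\<close>

lemma stationary_vec_positive:
  assumes A: "stochastic_mat n A" "irreducible_mat n A" and p: "stationary_vec n A p" and u: "u < n"
  shows "0 < p $ u"
proof -
  have C: "A \<in> carrier_mat n n" using A by (simp add: stochastic_mat_def)
  have pc: "p \<in> carrier_vec n" using p by (simp add: stationary_vec_def)
  have pow: "A ^\<^sub>m k \<in> carrier_mat n n" for k using C by (rule pow_carrier_mat)
  have nonneg: "0 \<le> (A ^\<^sub>m k) $$ (i, j)" if "i < n" "j < n" for k i j
    using that
  proof (induction k arbitrary: i j)
    case 0
    then show ?case using C by simp
  next
    case (Suc k)
    have "(A ^\<^sub>m Suc k) $$ (i, j) = (\<Sum>l = 0..<n. (A ^\<^sub>m k) $$ (i, l) * A $$ (l, j))"
      using Suc.prems C pow[of k] by (simp add: scalar_prod_def)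
    also have "\<dots> \<ge> 0"
      using Suc A by (intro sum_nonneg mult_nonneg_nonneg) (auto simp: stochastic_mat_def)
    finally show ?case .
  qed
  have pA: "(\<Sum>i = 0..<n. p $ i * A $$ (i, j)) = p $ j" if "j < n" for j
  proof -
    have "(transpose_mat A *\<^sub>v p) $ j = p $ j" using p by (simp add: stationary_vec_def)
    then show ?thesis using that C pc by (simp add: scalar_prod_def mult.commute)
  qed
  have pk: "(\<Sum>i = 0..<n. p $ i * (A ^\<^sub>m k) $$ (i, j)) = p $ j" if "j < n" for k j
    using that
  proof (induction k arbitrary: j)
    case 0
    have "(\<Sum>i = 0..<n. p $ i * (1\<^sub>m n) $$ (i, j)) = (\<Sum>i = 0..<n. if i = j then p $ i else 0)"
      using 0 by (intro sum.cong) auto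
    then show ?case using 0 C by simp
  next
    case (Suc k)
    have "(\<Sum>i = 0..<n. p $ i * (A ^\<^sub>m Suc k) $$ (i, j))
        = (\<Sum>i = 0..<n. \<Sum>l = 0..<n. p $ i * (A ^\<^sub>m k) $$ (i, l) * A $$ (l, j))"
      using Suc.prems C pow[of k] by (simp add: scalar_prod_def sum_distrib_left mult.assoc)
    also have "\<dots> = (\<Sum>l = 0..<n. (\<Sum>i = 0..<n. p $ i * (A ^\<^sub>m k) $$ (i, l)) * A $$ (l, j))"
      by (subst sum.swap) (simp add: sum_distrib_right)
    also have "\<dots> = (\<Sum>l = 0..<n. p $ l * A $$ (l, j))"
      using Suc.IH by simp
    finally show ?case using pA Suc.prems by simp
  qed
  obtain v where v: "v < n" "0 < p $ v"
  proof -
    have "\<not> (\<forall>v<n. p $ v = 0)"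
    proof
      assume "\<forall>v<n. p $ v = 0"
      then have "(\<Sum>v<n. p $ v) = 0" by (intro sum.neutral) auto
      then show False using p by (simp add: stationary_vec_def)
    qed
    then show ?thesis using that p by (force simp: stationary_vec_def order_less_le)
  qed
  obtain k where k: "0 < (A ^\<^sub>m k) $$ (v, u)"
    using A(2) v u by (auto simp: irreducible_mat_def)
  have "0 < p $ v * (A ^\<^sub>m k) $$ (v, u)" using v k by simp
  also have "\<dots> \<le> (\<Sum>i = 0..<n. p $ i * (A ^\<^sub>m k) $$ (i, u))"
    using p v nonneg u by (intro member_le_sum) (auto simp: stationary_vec_def)
  finally show ?thesis using pk[OF u] by simp
qed

text \<open>Distinct coordinates of a step are independent. Writing the integrand as a product over
  all coordinates, with factor 1 away from u and v, fits the product rule for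
  \<open>Pi_pmf\<close>.\<close>

lemma expectation_voter_step_pair:
  assumes A: "voter_parameter n A" and x: "x \<in> states n" and uv: "u < n" "v < n" "u \<noteq> v"
  shows "measure_pmf.expectation (voter_step n A x) (\<lambda>y. of_bool (y u) * (1 - of_bool (y v)))
           = row_mean n A u x * (1 - row_mean n A v x)"
proof -
  have prod2: "(\<Prod>w<n. if w = u then a else if w = v then b else 1) = a * b" for a b :: real
  proof -
    have "(\<Prod>w<n. if w = u then a else if w = v then b else 1)
        = (\<Prod>w<n. (if w = u then a else 1) * (if w = v then b else 1))"
      using uv by (intro prod.cong) auto
    then show ?thesis using uv by (simp add: prod.distrib)
  qed
  have q: "row_mean n A w x \<in> {0..1}" if "w < n" for w
    using A x that by (auto simp: voter_parameter_def)
  define f :: "nat \<Rightarrow> bool \<Rightarrow> real" where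
    "f = (\<lambda>w b. if w = u then of_bool b else if w = v then 1 - of_bool b else 1)"
  have "(\<Prod>w<n. f w (y w)) = of_bool (y u) * (1 - of_bool (y v))" for y
    unfolding prod2[symmetric] by (intro prod.cong) (auto simp: f_def)
  then have "measure_pmf.expectation (voter_step n A x) (\<lambda>y. of_bool (y u) * (1 - of_bool (y v)))
      = measure_pmf.expectation (voter_step n A x) (\<lambda>y. \<Prod>w<n. f w (y w))"
    by simp
  also have "\<dots> = (\<Prod>w<n. measure_pmf.expectation (bernoulli_pmf (row_mean n A w x)) (f w))"
    unfolding voter_step_def
    by (intro expectation_prod_Pi_pmf) (auto simp: f_def integrable_measure_pmf_finite)
  also have "\<dots> = (\<Prod>w<n. if w = u then row_mean n A u x else if w = v then 1 - row_mean n A v x else 1)"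
    using q by (intro prod.cong refl) (auto simp: f_def)
  finally show ?thesis by (simp add: prod2)
qed

locale voter_model = voter_chain +
  fixes p :: "real vec"
  assumes n2: "2 \<le> n" and irred: "irreducible_mat n A" and stat: "stationary_vec n A p"
    and Phi_pos: "0 < Phi n A p"
begin

abbreviation "\<Phi> \<equiv> Phi n A p"

definition pmin :: real where "pmin = Min ((\<lambda>v. p $ v) ` {..<n})"

text \<open>Variance of the opinion of a node drawn from p, and the denominator in
  \<open>Phi\<close>. On \<open>states n\<close> it vanishes exactly at consensus and serves as a
  Lyapunov function.\<close>

definition disagreement :: "state \<Rightarrow> real" where
  "disagreement x = (let y = scalar_prod p (state_vec n x) in y * (1 - y))"

section \<open>Stationary weights and the drift of the disagreement\<close>

lemma carrier_A: "A \<in> carrier_mat n n" using stoch by (simp add: stochastic_mat_def)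

lemma parameter_A: "voter_parameter n A" using stoch by (rule stochastic_imp_voter_parameter)

lemma p_pos: "u < n \<Longrightarrow> 0 < p $ u"
  using stoch irred stat by (rule stationary_vec_positive)

lemma p_sum: "(\<Sum>v<n. p $ v) = 1" using stat by (simp add: stationary_vec_def)

lemma pmin_le: "v < n \<Longrightarrow> pmin \<le> p $ v"
  unfolding pmin_def by (intro Min_le) auto

lemma pmin_pos: "0 < pmin"
proof -
  have "{..<n} \<noteq> {}" using n2 by (simp add: lessThan_empty_iff)
  then show ?thesis unfolding pmin_def using p_pos by (subst Min_gr_iff) auto
qed

lemma pmin_bound: "real n * pmin \<le> 1"
proof -
  have "real n * pmin = (\<Sum>v<n. pmin)" by simp
  also have "\<dots> \<le> (\<Sum>v<n. p $ v)" by (intro sum_mono pmin_le) auto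
  finally show ?thesis by (simp add: p_sum)
qed

lemma wmean_eq: "scalar_prod p (state_vec n x) = (\<Sum>v<n. p $ v * of_bool (x v))"
  by (auto simp: scalar_prod_def state_vec_def lessThan_atLeast0 intro!: sum.cong)

lemma wmean_compl: "1 - scalar_prod p (state_vec n x) = (\<Sum>v<n. p $ v * (1 - of_bool (x v)))"
  using p_sum by (simp add: wmean_eq right_diff_distrib sum_subtractf)

text \<open>This is where stationarity enters: it makes the weighted opinion p^T X_t a
  martingale.\<close>

lemma wmean_step: "(\<Sum>u<n. p $ u * row_mean n A u x) = scalar_prod p (state_vec n x)"
proof -
  have "(\<Sum>u<n. p $ u * row_mean n A u x) = (\<Sum>u<n. \<Sum>v<n. p $ u * A $$ (u, v) * of_bool (x v))"
    by (intro sum.cong refl) (simp add: row_mean_eq[OF carrier_A] sum_distrib_left mult.assoc del: sum_mult_of_bool_eq)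
  also have "\<dots> = (\<Sum>v<n. (\<Sum>u<n. p $ u * A $$ (u, v)) * of_bool (x v))"
    by (subst sum.swap) (simp add: sum_distrib_right)
  also have "\<dots> = (\<Sum>v<n. p $ v * of_bool (x v))"
  proof (intro sum.cong refl)
    fix v assume "v \<in> {..<n}"
    moreover have "(transpose_mat A *\<^sub>v p) $ v = p $ v" using stat by (simp add: stationary_vec_def)
    ultimately have "(\<Sum>u<n. p $ u * A $$ (u, v)) = p $ v"
      using carrier_A stat
      by (auto simp: stationary_vec_def scalar_prod_def mult.commute lessThan_atLeast0 intro!: sum.cong)
    then show "(\<Sum>u<n. p $ u * A $$ (u, v)) * of_bool (x v) = p $ v * of_bool (x v)" by simp
  qed
  finally show ?thesis by (simp add: wmean_eq)
qed

lemma wmean_bounds: "0 \<le> scalar_prod p (state_vec n x)" "scalar_prod p (state_vec n x) \<le> 1"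
proof -
  show "0 \<le> scalar_prod p (state_vec n x)"
    unfolding wmean_eq using p_pos by (intro sum_nonneg) (simp add: less_imp_le)
  have "0 \<le> 1 - scalar_prod p (state_vec n x)"
    unfolding wmean_compl using p_pos by (intro sum_nonneg) (simp add: less_imp_le)
  then show "scalar_prod p (state_vec n x) \<le> 1" by simp
qed

lemma disagreement_bounds: "0 \<le> disagreement x" "disagreement x \<le> 1 / 4"
proof -
  show "0 \<le> disagreement x" using wmean_bounds[of x] by (simp add: disagreement_def Let_def)
  have "0 \<le> (scalar_prod p (state_vec n x) - 1 / 2)\<^sup>2" by simp
  then show "disagreement x \<le> 1 / 4"
    by (simp add: disagreement_def Let_def power2_eq_square algebra_simps)
qed

text \<open>Without consensus there is a node of either opinion, so y and 1 - y are both at least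
  \<open>pmin\<close>, and one of them is at least 1/2.\<close>

lemma disagreement_ge:
  assumes "x \<in> states n - consensus n"
  shows "pmin / 2 \<le> disagreement x"
proof -
  let ?y = "scalar_prod p (state_vec n x)"
  have "\<exists>v<n. x v"
  proof (rule ccontr)
    assume "\<not> (\<exists>v<n. x v)"
    then have "x = (\<lambda>_. False)" using assms by (auto simp: states_def fun_eq_iff) (meson not_less)
    then show False using assms by (simp add: consensus_def)
  qed
  then obtain v where v: "v < n" "x v" by auto
  have "\<exists>v<n. \<not> x v"
  proof (rule ccontr)
    assume "\<not> (\<exists>v<n. \<not> x v)"
    then have "x = (\<lambda>v. v < n)" using assms by (auto simp: states_def fun_eq_iff) (meson not_less)
    then show False using assms by (simp add: consensus_def)
  qed
  then obtain w where w: "w < n" "\<not> x w" by auto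
  have "p $ v * of_bool (x v) \<le> ?y"
    unfolding wmean_eq using p_pos v by (intro member_le_sum) (auto simp: less_imp_le)
  then have 1: "pmin \<le> ?y" using pmin_le[OF v(1)] v by simp
  have "p $ w * (1 - of_bool (x w)) \<le> 1 - ?y"
    unfolding wmean_compl using p_pos w by (intro member_le_sum) (auto simp: less_imp_le)
  then have 2: "pmin \<le> 1 - ?y" using pmin_le[OF w(1)] w by simp
  show ?thesis
  proof (cases "?y \<le> 1 / 2")
    case True
    have "pmin * (1 / 2) \<le> ?y * (1 - ?y)"
      using 1 True pmin_pos by (intro mult_mono) auto
    then show ?thesis by (simp add: disagreement_def Let_def)
  next
    case False
    have "(1 / 2) * pmin \<le> ?y * (1 - ?y)"
      using 2 False pmin_pos by (intro mult_mono) auto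
    then show ?thesis by (simp add: disagreement_def Let_def)
  qed
qed

text \<open>The minimum in \<open>Phi\<close> omits the consensus states; there the disagreement is
  0 and the variances are nonnegative.\<close>

lemma Phi_disagreement_le:
  assumes x: "x \<in> states n"
  shows "\<Phi> * disagreement x \<le> (\<Sum>u<n. (p $ u)\<^sup>2 * bernoulli_var n A u x)"
proof (cases "x \<in> consensus n")
  case True
  have "disagreement x = 0"
    using True wmean_compl[of x] by (auto simp: consensus_def disagreement_def Let_def wmean_eq)
  moreover have "0 \<le> (\<Sum>u<n. (p $ u)\<^sup>2 * bernoulli_var n A u x)"
    using parameter_A x by (intro sum_nonneg) (auto simp: bernoulli_var_def voter_parameter_def)
  ultimately show ?thesis by simp
next
  case False
  then have x': "x \<in> states n - consensus n" using x by simp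
  let ?f = "\<lambda>x. (\<Sum>u<n. (p $ u)\<^sup>2 * bernoulli_var n A u x)
       / (scalar_prod p (state_vec n x) * (1 - scalar_prod p (state_vec n x)))"
  have "\<Phi> \<le> ?f x"
    unfolding Phi_def using x' by (intro Min_le) auto
  moreover have "0 < disagreement x" using disagreement_ge[OF x'] pmin_pos by simp
  ultimately show ?thesis
    by (simp add: disagreement_def Let_def pos_le_divide_eq)
qed

text \<open>Expand y (1 - y) into the terms p_u p_v y_u (1 - y_v). For u \<noteq> v independence
  replaces opinions by their means, while the diagonal terms vanish. Completing the product of means
  by its diagonal costs exactly the variances, and the completed product is the old disagreement by
  the martingale property.\<close>

lemma expectation_disagreement_step:
  assumes x: "x \<in> states n"
  shows "measure_pmf.expectation (voter_step n A x) disagreement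
           = disagreement x - (\<Sum>u<n. (p $ u)\<^sup>2 * bernoulli_var n A u x)"
proof -
  let ?E = "measure_pmf.expectation (voter_step n A x)"
  let ?q = "\<lambda>u. row_mean n A u x"
  have D: "disagreement y = (\<Sum>u<n. \<Sum>v<n. p $ u * p $ v * (of_bool (y u) * (1 - of_bool (y v))))" for y
    unfolding disagreement_def Let_def wmean_compl unfolding wmean_eq sum_product
    by (intro sum.cong refl) (simp only: mult_ac)
  have int: "integrable (measure_pmf (voter_step n A x)) (f :: state \<Rightarrow> real)" for f
    by (rule integrable_measure_pmf_finite) simp
  have q1: "1 - scalar_prod p (state_vec n x) = (\<Sum>v<n. p $ v * (1 - ?q v))"
    using p_sum by (simp add: right_diff_distrib sum_subtractf wmean_step)
  have "?E disagreement = (\<Sum>u<n. \<Sum>v<n. p $ u * p $ v * ?E (\<lambda>y. of_bool (y u) * (1 - of_bool (y v))))"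
    unfolding D[abs_def] by (simp add: int Bochner_Integration.integral_sum)
  also have "\<dots> = (\<Sum>u<n. \<Sum>v<n. p $ u * p $ v * (?q u * (1 - ?q v))
                  - (if u = v then (p $ u)\<^sup>2 * bernoulli_var n A u x else 0))"
  proof (intro sum.cong refl)
    fix u v assume "u \<in> {..<n}" "v \<in> {..<n}"
    then have uv: "u < n" "v < n" by auto
    show "p $ u * p $ v * ?E (\<lambda>y. of_bool (y u) * (1 - of_bool (y v)))
        = p $ u * p $ v * (?q u * (1 - ?q v)) - (if u = v then (p $ u)\<^sup>2 * bernoulli_var n A u x else 0)"
    proof (cases "u = v")
      case True
      have "(\<lambda>y :: state. of_bool (y u) * (1 - of_bool (y u)) :: real) = (\<lambda>_. 0)"
        by (auto simp: fun_eq_iff)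
      then show ?thesis using True by (simp add: bernoulli_var_def power2_eq_square)
    next
      case False
      then show ?thesis using expectation_voter_step_pair[OF parameter_A x uv] by simp
    qed
  qed
  also have "\<dots> = (\<Sum>u<n. p $ u * ?q u) * (\<Sum>v<n. p $ v * (1 - ?q v))
       - (\<Sum>u<n. (p $ u)\<^sup>2 * bernoulli_var n A u x)"
    by (simp add: sum_subtractf sum_product mult_ac)
  also have "(\<Sum>u<n. p $ u * ?q u) * (\<Sum>v<n. p $ v * (1 - ?q v)) = disagreement x"
    by (simp add: wmean_step q1[symmetric] disagreement_def Let_def)
  finally show ?thesis .
qed

lemma expectation_disagreement_step_le:
  assumes x: "x \<in> states n"
  shows "measure_pmf.expectation (voter_step n A x) disagreement \<le> (1 - \<Phi>) * disagreement x"
  using expectation_disagreement_step[OF x] Phi_disagreement_le[OF x] by (simp add: algebra_simps)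

text \<open>Apply the contraction to the state in which only node 0 has opinion 1: a nonnegative
  mean is at most 1 - \<Phi> times a positive number. This keeps the powers of 1 - \<Phi>
  nonnegative.\<close>

lemma Phi_le_1: "\<Phi> \<le> 1"
proof -
  define x :: state where "x = (\<lambda>v. v = 0)"
  have "x 1 \<noteq> (1 < n)" "x 0 \<noteq> False"
    using n2 by (auto simp: x_def)
  then have "x \<noteq> (\<lambda>v. v < n)" "x \<noteq> (\<lambda>_. False)"
    by metis+
  then have x: "x \<in> states n - consensus n"
    using n2 by (simp add: states_def consensus_def) (simp add: x_def)
  then have pos: "0 < disagreement x" using disagreement_ge[OF x] pmin_pos by simp
  have "0 \<le> measure_pmf.expectation (voter_step n A x) disagreement"
    by (intro Bochner_Integration.integral_nonneg disagreement_bounds)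
  also have "\<dots> \<le> (1 - \<Phi>) * disagreement x"
    using x by (intro expectation_disagreement_step_le) auto
  finally show ?thesis using pos by (simp add: zero_le_mult_iff)
qed

lemma nn_integral_disagreement_step:
  assumes x: "x \<in> states n"
  shows "(\<integral>\<^sup>+y. ennreal (disagreement y) \<partial>measure_pmf (voter_step n A x))
           \<le> ennreal (1 - \<Phi>) * ennreal (disagreement x)"
proof -
  have "(\<integral>\<^sup>+y. ennreal (disagreement y) \<partial>measure_pmf (voter_step n A x))
      = ennreal (measure_pmf.expectation (voter_step n A x) disagreement)"
    by (intro nn_integral_eq_integral integrable_measure_pmf_finite)
       (simp_all add: disagreement_bounds)
  also have "\<dots> \<le> ennreal ((1 - \<Phi>) * disagreement x)"
    using x by (intro ennreal_leI expectation_disagreement_step_le)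
  also have "\<dots> = ennreal (1 - \<Phi>) * ennreal (disagreement x)"
    using Phi_le_1 disagreement_bounds by (intro ennreal_mult) auto
  finally show ?thesis .
qed

lemma nn_integral_disagreement:
  "(\<integral>\<^sup>+\<omega>. ennreal (disagreement (\<omega> t)) \<partial>P) \<le> ennreal ((1 - \<Phi>) ^ t / 4)"
proof (induction t)
  case 0
  have "(\<integral>\<^sup>+\<omega>. ennreal (disagreement (\<omega> 0)) \<partial>P) \<le> (\<integral>\<^sup>+\<omega>. ennreal (1 / 4) \<partial>P)"
    by (intro nn_integral_mono ennreal_leI disagreement_bounds)
  then show ?case using emeasure_space_1 by (simp del: ennreal_divide_numeral)
next
  case (Suc t)
  have "(\<integral>\<^sup>+\<omega>. ennreal (disagreement (\<omega> (Suc t))) \<partial>P)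
      = (\<integral>\<^sup>+\<omega>. (\<integral>\<^sup>+y. ennreal (disagreement y) \<partial>measure_pmf (voter_step n A (\<omega> t))) \<partial>P)"
    by (rule nn_integral_Suc) simp
  also have "\<dots> \<le> (\<integral>\<^sup>+\<omega>. ennreal (1 - \<Phi>) * ennreal (disagreement (\<omega> t)) \<partial>P)"
    using AE_states by (intro nn_integral_mono_AE) (auto elim!: eventually_mono intro!: nn_integral_disagreement_step)
  also have "\<dots> = ennreal (1 - \<Phi>) * (\<integral>\<^sup>+\<omega>. ennreal (disagreement (\<omega> t)) \<partial>P)"
    by (intro nn_integral_cmult component_fun)
  also have "\<dots> \<le> ennreal (1 - \<Phi>) * ennreal ((1 - \<Phi>) ^ t / 4)"
    by (intro mult_left_mono Suc) simp
  also have "\<dots> = ennreal ((1 - \<Phi>) ^ Suc t / 4)"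
    using Phi_le_1 by (simp flip: ennreal_mult)
  finally show ?case .
qed

end

section \<open>The consensus time\<close>

text \<open>The event \<tau> > t, expressed by the states up to time t. Time 0 is left out because
  \<tau> only looks at t \<ge> 1, even when the initial state is a consensus.\<close>

definition alive :: "nat \<Rightarrow> nat \<Rightarrow> (nat \<Rightarrow> state) \<Rightarrow> bool" where
  "alive n t \<omega> \<longleftrightarrow> (\<forall>r\<in>{1..t}. \<omega> r \<notin> consensus n)"

lemma less_consensus_time_iff: "enat t < consensus_time n \<omega> \<longleftrightarrow> alive n t \<omega>"
proof
  assume L: "enat t < consensus_time n \<omega>"
  show "alive n t \<omega>"
    unfolding alive_def
  proof (intro ballI notI)
    fix r assume r: "r \<in> {1..t}" "\<omega> r \<in> consensus n"
    then have "consensus_time n \<omega> \<le> enat r"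
      unfolding consensus_time_def by (intro Inf_lower) auto
    also have "\<dots> \<le> enat t" using r by simp
    finally show False using L by simp
  qed
next
  assume "alive n t \<omega>"
  then have "enat (Suc t) \<le> consensus_time n \<omega>"
    unfolding consensus_time_def alive_def by (intro Inf_greatest) (force simp: not_less_eq_eq)
  then show "enat t < consensus_time n \<omega>"
    by (metis enat_ord_simps(2) lessI less_le_trans)
qed

text \<open>Common shape of \<tau>, the gradient entries and the Gram entries. On a path without
  consensus the index set is infinite and the value is 0.\<close>

definition path_sum :: "nat \<Rightarrow> (nat \<Rightarrow> (nat \<Rightarrow> state) \<Rightarrow> real) \<Rightarrow> (nat \<Rightarrow> state) \<Rightarrow> real" where
  "path_sum n f \<omega> = (\<Sum>t | enat t < consensus_time n \<omega>. f t \<omega>)"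

abbreviation tau :: "nat \<Rightarrow> (nat \<Rightarrow> state) \<Rightarrow> real" where
  "tau n \<equiv> path_sum n (\<lambda>_ _. 1)"

lemma path_sum_enat: "consensus_time n \<omega> = enat k \<Longrightarrow> path_sum n f \<omega> = (\<Sum>t<k. f t \<omega>)"
  unfolding path_sum_def by (auto intro!: sum.cong)

lemma path_sum_alive: "path_sum n f \<omega> = (\<Sum>t | alive n t \<omega>. f t \<omega>)"
  by (simp add: path_sum_def less_consensus_time_iff)

lemma consensus_time_ge_1: "1 \<le> consensus_time n \<omega>"
  unfolding consensus_time_def by (intro Inf_greatest) (auto simp: one_enat_def)

context voter_chain
begin

section \<open>Measurability of sums up to consensus\<close>

lemma alive_pred [measurable]: "Measurable.pred P (\<lambda>\<omega>. alive n t \<omega>)"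
  unfolding alive_def by (intro pred_intros_finite component_set) auto

lemma alive_set: "{\<omega>. alive n t \<omega>} \<in> sets P"
  using alive_pred[of t] by (simp add: pred_def)

text \<open>The index set depends on the path. A series with indicators is measurable and agrees
  with the sum on every path that stops; the other paths are split off, since there the sum takes
  its default value 0.\<close>

lemma path_sum_measurable:
  assumes [measurable]: "\<And>t. f t \<in> borel_measurable P"
  shows "path_sum n f \<in> borel_measurable P"
proof -
  have "path_sum n f \<omega> = (if \<forall>t. alive n t \<omega> then 0 else (\<Sum>t. if alive n t \<omega> then f t \<omega> else 0))" for \<omega>
  proof (cases "\<forall>t. alive n t \<omega>")
    case True
    then show ?thesis by (simp add: path_sum_alive)
  next
    case False
    then obtain s where "\<not> alive n s \<omega>" by auto
    then have "{t. alive n t \<omega>} \<subseteq> {..<s}"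
      by (force simp: alive_def not_less)
    then have fin: "finite {t. alive n t \<omega>}" by (rule finite_subset) simp
    have "(\<Sum>t. if alive n t \<omega> then f t \<omega> else 0) = (\<Sum>t | alive n t \<omega>. if alive n t \<omega> then f t \<omega> else 0)"
      by (rule suminf_finite[OF fin]) auto
    also have "\<dots> = (\<Sum>t | alive n t \<omega>. f t \<omega>)" by (intro sum.cong) auto
    finally show ?thesis using False by (simp add: path_sum_alive)
  qed
  moreover have "(\<lambda>\<omega>. if \<forall>t. alive n t \<omega> then 0 else (\<Sum>t. if alive n t \<omega> then f t \<omega> else 0)) \<in> borel_measurable P"
    by measurable
  ultimately show ?thesis by (simp add: fun_eq_iff[symmetric] cong: measurable_cong)
qed

end

lemma exp_minus_power: "exp (- a * real t) = exp (- a :: real) ^ t"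
  by (subst exp_of_nat_mult[symmetric]) (simp add: mult.commute)

context voter_model
begin

text \<open>Ratio of the bound 1/4 on the disagreement to its lower bound \<open>pmin / 2\<close>
  before consensus. It is the prefactor in the tail of \<tau>, and its logarithm is the one
  occurring in the theorem.\<close>

definition B :: real where "B = 1 / (2 * pmin)"

lemma B_ge: "real n \<le> 2 * B" "1 \<le> B"
proof -
  show "real n \<le> 2 * B"
    using pmin_bound pmin_pos by (simp add: B_def field_simps)
  then show "1 \<le> B" using n2 by linarith
qed

text \<open>Markov's inequality for the disagreement, which is at least \<open>pmin / 2\<close>
  before consensus and has mean at most (1 - \<Phi>)^t / 4.\<close>

lemma emeasure_alive_le: "emeasure P {\<omega>. alive n t \<omega>} \<le> ennreal (B * exp (- \<Phi> * t))"
proof (cases "t = 0")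
  \<comment> \<open>Being alive at time 0 says nothing about the initial state, so here the bound
    rests on B \<ge> 1.\<close>
  case True
  have "emeasure P {\<omega>. alive n t \<omega>} \<le> 1" by (rule emeasure_le_1)
  also have "\<dots> \<le> ennreal (B * exp (- \<Phi> * t))" using True B_ge by simp
  finally show ?thesis .
next
  case False
  have "ennreal (pmin / 2) * emeasure P {\<omega>. alive n t \<omega>}
      = (\<integral>\<^sup>+\<omega>. ennreal (pmin / 2) * indicator {\<omega>. alive n t \<omega>} \<omega> \<partial>P)"
    by (simp add: nn_integral_cmult_indicator alive_set)
  also have "\<dots> \<le> (\<integral>\<^sup>+\<omega>. ennreal (disagreement (\<omega> t)) \<partial>P)"
    using AE_states False
    by (intro nn_integral_mono_AE)
       (auto elim!: eventually_mono intro!: ennreal_leI disagreement_ge simp: alive_def split: split_indicator)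
  also have "\<dots> \<le> ennreal ((1 - \<Phi>) ^ t / 4)" by (rule nn_integral_disagreement)
  also have "\<dots> \<le> ennreal (exp (- \<Phi> * t) / 4)"
  proof (intro ennreal_leI divide_right_mono)
    have "1 - \<Phi> \<le> exp (- \<Phi>)" using exp_ge_add_one_self[of "- \<Phi>"] by simp
    then have "(1 - \<Phi>) ^ t \<le> exp (- \<Phi>) ^ t" using Phi_le_1 by (intro power_mono) auto
    then show "(1 - \<Phi>) ^ t \<le> exp (- \<Phi> * t)" by (simp only: exp_minus_power)
  qed simp
  finally have "ennreal (2 / pmin) * (ennreal (pmin / 2) * emeasure P {\<omega>. alive n t \<omega>})
      \<le> ennreal (2 / pmin) * ennreal (exp (- \<Phi> * t) / 4)"
    by (intro mult_left_mono) auto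
  moreover have "ennreal (2 / pmin) * ennreal (pmin / 2) = 1"
    using pmin_pos by (subst ennreal_mult[symmetric]) auto
  moreover have "ennreal (2 / pmin) * ennreal (exp (- \<Phi> * t) / 4) = ennreal (B * exp (- \<Phi> * t))"
    using pmin_pos by (subst ennreal_mult[symmetric]) (auto simp: B_def)
  ultimately show ?thesis by (metis mult.assoc mult_1)
qed

lemma AE_consensus_time: "AE \<omega> in P. \<exists>k>0. consensus_time n \<omega> = enat k"
proof -
  have S: "{\<omega>. \<forall>t. alive n t \<omega>} \<in> sets P"
  proof -
    have "Measurable.pred P (\<lambda>\<omega>. \<forall>t. alive n t \<omega>)" by measurable
    then show ?thesis by (simp add: pred_def)
  qed
  have "measure P {\<omega>. \<forall>t. alive n t \<omega>} \<le> B * exp (- \<Phi>) ^ t" for t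
  proof -
    have "emeasure P {\<omega>. \<forall>t. alive n t \<omega>} \<le> emeasure P {\<omega>. alive n t \<omega>}"
      by (intro emeasure_mono alive_set) auto
    also have "\<dots> \<le> ennreal (B * exp (- \<Phi>) ^ t)"
      using emeasure_alive_le[of t] by (simp only: exp_minus_power)
    finally show ?thesis using B_ge by (simp add: emeasure_eq_measure)
  qed
  moreover have "(\<lambda>t. B * exp (- \<Phi>) ^ t) \<longlonglongrightarrow> B * 0"
    using Phi_pos by (intro tendsto_mult tendsto_const LIMSEQ_power_zero) auto
  ultimately have "measure P {\<omega>. \<forall>t. alive n t \<omega>} \<le> 0"
    by (intro LIMSEQ_le_const[of _ _ "measure P {\<omega>. \<forall>t. alive n t \<omega>}"]) auto
  then have "emeasure P {\<omega>. \<forall>t. alive n t \<omega>} = 0"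
    by (simp add: emeasure_eq_measure measure_le_0_iff)
  then have "AE \<omega> in P. \<not> (\<forall>t. alive n t \<omega>)"
    using S by (intro AE_I[where N = "{\<omega>. \<forall>t. alive n t \<omega>}"]) auto
  then show ?thesis
  proof eventually_elim
    case (elim \<omega>)
    then obtain k where k: "consensus_time n \<omega> = enat k"
      by (cases "consensus_time n \<omega>") (auto simp flip: less_consensus_time_iff)
    then show ?case using consensus_time_ge_1[of n \<omega>] by (auto simp: one_enat_def)
  qed
qed

text \<open>With \<tau> in the role of k, the exponential is telescoped from time t0 on and each
  increment carries the indicator of survival, so its mean can be read off the tail of \<tau>. The
  first t0 steps are paid for in full.\<close>

lemma exp_tau_le:
  fixes k t0 :: nat and \<theta> :: real
  assumes \<theta>: "0 \<le> \<theta>" and al: "\<And>t. t < k \<Longrightarrow> alive n t \<omega>"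
  shows "ennreal (exp (\<theta> * k)) \<le> ennreal (exp (\<theta> * t0)) *
     (1 + (\<Sum>t. ennreal (exp (\<theta> * Suc t) - exp (\<theta> * t)) * indicator {\<omega>. alive n (t0 + t) \<omega>} \<omega>))"
proof (cases "k \<le> t0")
  case True
  have "ennreal (exp (\<theta> * k)) \<le> ennreal (exp (\<theta> * t0)) * 1"
    using True \<theta> by (auto intro!: ennreal_leI mult_left_mono)
  also have "\<dots> \<le> ennreal (exp (\<theta> * t0)) *
     (1 + (\<Sum>t. ennreal (exp (\<theta> * Suc t) - exp (\<theta> * t)) * indicator {\<omega>. alive n (t0 + t) \<omega>} \<omega>))"
    by (intro mult_left_mono) auto
  finally show ?thesis .
next
  case False
  then obtain j where j: "k = t0 + j" by (metis le_add_diff_inverse nat_le_linear)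
  have m: "exp (\<theta> * t) \<le> exp (\<theta> * Suc t)" for t using \<theta> by (simp add: algebra_simps)
  have "exp (\<theta> * k) = exp (\<theta> * t0) * (1 + (exp (\<theta> * j) - exp (\<theta> * 0)))"
    by (simp add: j distrib_left exp_add)
  also have "exp (\<theta> * j) - exp (\<theta> * 0) = (\<Sum>t<j. exp (\<theta> * Suc t) - exp (\<theta> * t))"
    using sum_lessThan_telescope[of "\<lambda>t. exp (\<theta> * real t)" j] by simp
  finally have "ennreal (exp (\<theta> * k)) = ennreal (exp (\<theta> * t0)) *
      (1 + (\<Sum>t<j. ennreal (exp (\<theta> * Suc t) - exp (\<theta> * t))))"
    using m by (simp add: ennreal_mult ennreal_plus sum_nonneg sum_ennreal del: of_nat_Suc)
  also have "(\<Sum>t<j. ennreal (exp (\<theta> * Suc t) - exp (\<theta> * t)))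
      = (\<Sum>t<j. ennreal (exp (\<theta> * Suc t) - exp (\<theta> * t)) * indicator {\<omega>. alive n (t0 + t) \<omega>} \<omega>)"
    using al j by (intro sum.cong) auto
  also have "\<dots> \<le> (\<Sum>t. ennreal (exp (\<theta> * Suc t) - exp (\<theta> * t)) * indicator {\<omega>. alive n (t0 + t) \<omega>} \<omega>)"
    by (intro sum_le_suminf) auto
  finally show ?thesis by (simp add: mult_left_mono add_left_mono)
qed

text \<open>The constant \<open>6 * sqrt B\<close> rather than a multiple of \<open>B\<close> comes from shifting by the time
  \<open>t0\<close> after which the tail bound \<open>B * exp (- \<Phi> * t)\<close> is non-trivial.\<close>

lemma nn_integral_exp_tau: "(\<integral>\<^sup>+\<omega>. ennreal (exp (\<Phi> / 2 * tau n \<omega>)) \<partial>P) \<le> ennreal (6 * sqrt B)"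
proof -
  \<comment> \<open>Half the decay rate: increments of order exp (\<theta> t) meet a tail of order
    exp (- 2 \<theta> t), which leaves a geometric series.\<close>
  define \<theta> where "\<theta> = \<Phi> / 2"
  have \<theta>: "0 < \<theta>" "\<theta> \<le> 1 / 2" using Phi_pos Phi_le_1 by (auto simp: \<theta>_def)
  define t0 where "t0 = nat \<lceil>ln B / \<Phi>\<rceil>"
  have lnB: "0 \<le> ln B" using B_ge by simp
  have t0: "ln B / \<Phi> \<le> t0" "t0 \<le> ln B / \<Phi> + 1"
    unfolding t0_def using lnB Phi_pos by (auto simp: of_nat_nat ceiling_le_iff)
  have t0': "ln B \<le> \<Phi> * t0" "\<Phi> * t0 \<le> ln B + \<Phi>"
    using t0 Phi_pos by (auto simp: field_simps)
  let ?d = "\<lambda>t. exp (\<theta> * real (Suc t)) - exp (\<theta> * real t)"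
  let ?I = "\<lambda>t. indicator {\<omega>. alive n (t0 + t) \<omega>} :: _ \<Rightarrow> ennreal"
  have d0: "0 \<le> ?d t" for t using \<theta> by simp
  have B0: "B * exp (- \<Phi> * t0) \<le> 1"
  proof -
    have "B * exp (- \<Phi> * t0) = exp (ln B - \<Phi> * t0)" using B_ge by (simp add: exp_diff exp_minus field_simps)
    also have "\<dots> \<le> 1" using t0' by simp
    finally show ?thesis .
  qed
  have e: "exp \<theta> \<le> 2"
  proof -
    have "exp \<theta> \<le> exp (1 / 2)" using \<theta> by simp
    also have "\<dots> \<le> 2" using exp_half_le2 by simp
    finally show ?thesis .
  qed
  have tail_term: "ennreal (?d t) * emeasure P {\<omega>. alive n (t0 + t) \<omega>} \<le> ennreal ((exp \<theta> - 1) * exp (- \<theta>) ^ t)" for t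
  proof -
    have "ennreal (?d t) * emeasure P {\<omega>. alive n (t0 + t) \<omega>} \<le> ennreal (?d t) * ennreal (B * exp (- \<Phi> * (t0 + t)))"
      using emeasure_alive_le[of "t0 + t"] by (intro mult_left_mono) auto
    also have "\<dots> = ennreal (?d t * (B * exp (- \<Phi> * (t0 + t))))"
      using d0 B_ge by (simp add: ennreal_mult)
    also have "\<dots> \<le> ennreal ((exp \<theta> - 1) * exp (- \<theta>) ^ t)"
    proof (rule ennreal_leI)
      have "?d t * (B * exp (- \<Phi> * (t0 + t))) = (exp \<theta> - 1) * exp (- \<theta> * t) * (B * exp (- \<Phi> * t0))"
        by (simp add: \<theta>_def algebra_simps exp_add[symmetric])
      also have "\<dots> \<le> (exp \<theta> - 1) * exp (- \<theta> * t) * 1"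
        using B0 \<theta> by (intro mult_left_mono) auto
      also have "\<dots> = (exp \<theta> - 1) * exp (- \<theta>) ^ t"
        by (simp only: exp_minus_power)
      finally show "?d t * (B * exp (- \<Phi> * (t0 + t))) \<le> (exp \<theta> - 1) * exp (- \<theta>) ^ t" .
    qed
    finally show ?thesis .
  qed
  have sums: "(\<lambda>t. (exp \<theta> - 1) * exp (- \<theta>) ^ t) sums ((exp \<theta> - 1) * (1 / (1 - exp (- \<theta>))))"
    using \<theta> by (intro sums_mult geometric_sums) auto
  have val: "(exp \<theta> - 1) * (1 / (1 - exp (- \<theta>))) = exp \<theta>"
    using \<theta> by (simp add: exp_minus field_simps)
  have "(\<integral>\<^sup>+\<omega>. ennreal (exp (\<theta> * tau n \<omega>)) \<partial>P)
      \<le> (\<integral>\<^sup>+\<omega>. ennreal (exp (\<theta> * t0)) * (1 + (\<Sum>t. ennreal (?d t) * ?I t \<omega>)) \<partial>P)"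
  proof (rule nn_integral_mono_AE)
    from AE_consensus_time show "AE \<omega> in P. ennreal (exp (\<theta> * tau n \<omega>))
        \<le> ennreal (exp (\<theta> * t0)) * (1 + (\<Sum>t. ennreal (?d t) * ?I t \<omega>))"
    proof eventually_elim
      case (elim \<omega>)
      then obtain k where k: "consensus_time n \<omega> = enat k" by auto
      then have "alive n t \<omega>" if "t < k" for t using that by (simp flip: less_consensus_time_iff)
      from exp_tau_le[OF less_imp_le[OF \<theta>(1)] this, of k t0] show ?case
        by (simp add: path_sum_enat[OF k])
    qed
  qed
  also have "\<dots> = ennreal (exp (\<theta> * t0)) * (1 + (\<Sum>t. ennreal (?d t) * emeasure P {\<omega>. alive n (t0 + t) \<omega>}))"
  proof -
    have [measurable]: "?I t \<in> borel_measurable P" for t using alive_set by simp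
    show ?thesis
      using emeasure_space_1
      by (simp add: nn_integral_cmult nn_integral_add nn_integral_suminf nn_integral_cmult_indicator alive_set)
  qed
  also have "\<dots> \<le> ennreal (exp (\<theta> * t0)) * (1 + (\<Sum>t. ennreal ((exp \<theta> - 1) * exp (- \<theta>) ^ t)))"
    by (intro mult_left_mono add_left_mono suminf_le tail_term) auto
  also have "(\<Sum>t. ennreal ((exp \<theta> - 1) * exp (- \<theta>) ^ t)) = ennreal (exp \<theta>)"
    using sums \<theta> unfolding val by (intro suminf_ennreal_eq) auto
  also have "ennreal (exp (\<theta> * t0)) * (1 + ennreal (exp \<theta>)) = ennreal (exp (\<theta> * t0) * (1 + exp \<theta>))"
    by (simp add: ennreal_mult ennreal_plus)
  also have "\<dots> \<le> ennreal (6 * sqrt B)"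
  proof (rule ennreal_leI)
    \<comment> \<open>Rounding t0 up costs a factor exp \<theta> \<le> 2 on top of sqrt B, and 1 +
      exp \<theta> \<le> 3; hence 6 = 2 * 3.\<close>
    have "exp (\<theta> * t0) \<le> exp (ln B / 2 + \<theta>)" using t0' by (simp add: \<theta>_def)
    also have "\<dots> = sqrt B * exp \<theta>"
      using B_ge by (simp add: exp_add ln_sqrt[symmetric])
    also have "\<dots> \<le> sqrt B * 2" using e B_ge by (intro mult_left_mono) auto
    finally have "exp (\<theta> * t0) * (1 + exp \<theta>) \<le> (sqrt B * 2) * 3"
      using e B_ge by (intro mult_mono) auto
    then show "exp (\<theta> * t0) * (1 + exp \<theta>) \<le> 6 * sqrt B" by simp
  qed
  finally show ?thesis by (simp add: \<theta>_def)
qed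

section \<open>Moments of the consensus time\<close>

lemma tau_measurable [measurable]: "tau n \<in> borel_measurable P"
  by (rule path_sum_measurable) simp

text \<open>Taking x = \<Phi> \<tau> / 2 in x^2 / 2 \<le> exp x gives \<tau>^2 \<le> 8 / \<Phi>^2 *
  exp x, and 48 = 8 * 6. Relaxing sqrt B to B produces the factor \<open>1 / pmin\<close> of the
  sample size condition.\<close>

lemma tau_moments:
  "integrable P (\<lambda>\<omega>. (tau n \<omega>)\<^sup>2)" "(\<integral>\<omega>. (tau n \<omega>)\<^sup>2 \<partial>P) \<le> 48 * B / \<Phi>\<^sup>2"
proof -
  have "(\<integral>\<^sup>+\<omega>. ennreal ((tau n \<omega>)\<^sup>2) \<partial>P) \<le> (\<integral>\<^sup>+\<omega>. ennreal (8 / \<Phi>\<^sup>2) * ennreal (exp (\<Phi> / 2 * tau n \<omega>)) \<partial>P)"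
  proof (intro nn_integral_mono)
    fix \<omega>
    have "0 \<le> \<Phi> / 2 * tau n \<omega>" using Phi_pos by (auto simp: path_sum_def intro!: mult_nonneg_nonneg sum_nonneg)
    from exp_lower_Taylor_quadratic[OF this] this
    have "(\<Phi> / 2 * tau n \<omega>)\<^sup>2 / 2 \<le> exp (\<Phi> / 2 * tau n \<omega>)" by linarith
    then have "(tau n \<omega>)\<^sup>2 \<le> 8 / \<Phi>\<^sup>2 * exp (\<Phi> / 2 * tau n \<omega>)"
      using Phi_pos by (simp add: field_simps power2_eq_square)
    then show "ennreal ((tau n \<omega>)\<^sup>2) \<le> ennreal (8 / \<Phi>\<^sup>2) * ennreal (exp (\<Phi> / 2 * tau n \<omega>))"
      by (simp add: ennreal_mult[symmetric] ennreal_leI)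
  qed
  also have "\<dots> = ennreal (8 / \<Phi>\<^sup>2) * (\<integral>\<^sup>+\<omega>. ennreal (exp (\<Phi> / 2 * tau n \<omega>)) \<partial>P)"
    by (intro nn_integral_cmult) measurable
  also have "\<dots> \<le> ennreal (8 / \<Phi>\<^sup>2) * ennreal (6 * sqrt B)"
    by (intro mult_left_mono nn_integral_exp_tau) simp
  also have "\<dots> = ennreal (48 * sqrt B / \<Phi>\<^sup>2)"
    using B_ge by (simp add: ennreal_mult[symmetric])
  also have "\<dots> \<le> ennreal (48 * B / \<Phi>\<^sup>2)"
    using B_ge sqrt_le_D[of B "B\<^sup>2"] by (intro ennreal_leI divide_right_mono mult_left_mono) (auto intro!: real_le_lsqrt simp: power2_eq_square)
  finally have le: "(\<integral>\<^sup>+\<omega>. ennreal ((tau n \<omega>)\<^sup>2) \<partial>P) \<le> ennreal (48 * B / \<Phi>\<^sup>2)" .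
  then show int: "integrable P (\<lambda>\<omega>. (tau n \<omega>)\<^sup>2)"
    by (intro integrableI_bounded) (auto simp: less_top[symmetric] top_unique)
  from le show "(\<integral>\<omega>. (tau n \<omega>)\<^sup>2 \<partial>P) \<le> 48 * B / \<Phi>\<^sup>2"
    using B_ge by (subst (asm) nn_integral_eq_integral[OF int]) auto
qed

lemma square_integrable_le_tau:
  assumes f: "f \<in> borel_measurable P" "\<And>\<omega>. \<bar>f \<omega>\<bar> \<le> tau n \<omega>"
  shows "integrable P (\<lambda>\<omega>. (f \<omega>)\<^sup>2)" "integrable P f" "(\<integral>\<omega>. (f \<omega>)\<^sup>2 \<partial>P) \<le> 48 * B / \<Phi>\<^sup>2"
proof -
  have le: "(f \<omega>)\<^sup>2 \<le> (tau n \<omega>)\<^sup>2" for \<omega>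
    using f(2)[of \<omega>] by (simp add: abs_le_square_iff[symmetric])
  show int: "integrable P (\<lambda>\<omega>. (f \<omega>)\<^sup>2)"
    using le f by (intro Bochner_Integration.integrable_bound[OF tau_moments(1)]) auto
  then show "integrable P f"
    by (rule square_integrable_imp_integrable[OF f(1)])
  have "(\<integral>\<omega>. (f \<omega>)\<^sup>2 \<partial>P) \<le> (\<integral>\<omega>. (tau n \<omega>)\<^sup>2 \<partial>P)"
    using le by (intro integral_mono int tau_moments)
  also have "\<dots> \<le> 48 * B / \<Phi>\<^sup>2" by (rule tau_moments)
  finally show "(\<integral>\<omega>. (f \<omega>)\<^sup>2 \<partial>P) \<le> 48 * B / \<Phi>\<^sup>2" .
qed

lemma tau_nonneg: "0 \<le> tau n \<omega>" by (simp add: path_sum_def)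

lemma integrable_tau: "integrable P (tau n)"
  by (rule square_integrable_le_tau) (auto simp: tau_nonneg)

text \<open>The \<open>enat\<close> time and its real counterpart differ only on paths without
  consensus, which form a null set.\<close>

lemma expected_consensus_time_eq: "expected_consensus_time n P = (\<integral>\<omega>. tau n \<omega> \<partial>P)"
proof -
  have "(\<integral>\<^sup>+\<omega>. ennreal_of_enat (consensus_time n \<omega>) \<partial>P) = (\<integral>\<^sup>+\<omega>. ennreal (tau n \<omega>) \<partial>P)"
    using AE_consensus_time
    by (intro nn_integral_cong_AE) (auto elim!: eventually_mono simp: path_sum_enat ennreal_of_nat_eq_real_of_nat)
  also have "\<dots> = ennreal (\<integral>\<omega>. tau n \<omega> \<partial>P)"
    by (intro nn_integral_eq_integral integrable_tau) (simp add: tau_nonneg)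
  finally show ?thesis
    by (simp add: expected_consensus_time_def tau_nonneg)
qed

lemma expected_consensus_time_ge_1: "1 \<le> expected_consensus_time n P"
proof -
  have "(\<integral>\<omega>. 1 \<partial>P) \<le> (\<integral>\<omega>. tau n \<omega> \<partial>P)"
    using AE_consensus_time
    by (intro integral_mono_AE integrable_tau) (auto elim!: eventually_mono simp: path_sum_enat)
  then show ?thesis using prob_space by (simp add: expected_consensus_time_eq)
qed

end

section \<open>The score martingale\<close>

text \<open>Hoeffding's lemma: for 0 < q < 1 the score has mean 0 and two values at distance 1/q +
  1/(1 - q) \<le> 2/\<alpha>, and (2/\<alpha>)^2 / 8 = 1 / (2 \<alpha>^2). The sign \<sigma> serves
  to treat both tails.\<close>

lemma nn_integral_exp_score_bernoulli:
  fixes q \<alpha> l \<sigma> :: real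
  assumes q: "0 \<le> q" "q \<le> 1" "q \<noteq> 0 \<Longrightarrow> \<alpha> \<le> q" "q \<noteq> 1 \<Longrightarrow> \<alpha> \<le> 1 - q"
    and pos: "0 < \<alpha>" "0 < l" and \<sigma>: "\<bar>\<sigma>\<bar> = 1"
  shows "(\<integral>\<^sup>+b. ennreal (exp (l * (\<sigma> * score q b))) \<partial>measure_pmf (bernoulli_pmf q))
           \<le> ennreal (exp (l\<^sup>2 / (2 * \<alpha>\<^sup>2)))"
proof (cases "0 < q \<and> q < 1")
  case False
  then have "score q b = 0" for b by (auto simp: score_def)
  then show ?thesis by (simp add: measure_pmf.emeasure_space_1[simplified])
next
  case True
  then have q01: "0 < q" "q < 1" by auto
  define d where "d = 1 / (q * (1 - q))"
  define a where "a = (if \<sigma> = 1 then - 1 / (1 - q) else - 1 / q)"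
  define b where "b = (if \<sigma> = 1 then 1 / q else 1 / (1 - q))"
  have sc: "score q True = 1 / q" "score q False = - 1 / (1 - q)"
    using q01 by (auto simp: score_def)
  have \<sigma>': "\<sigma> = 1 \<or> \<sigma> = - 1" using \<sigma> by linarith
  interpret interval_bounded_random_variable "measure_pmf (bernoulli_pmf q)" "\<lambda>x. \<sigma> * score q x" a b
  proof
    show "AE x in measure_pmf (bernoulli_pmf q). \<sigma> * score q x \<in> {a..b}"
    proof (rule AE_I2)
      fix x
      have "0 \<le> 1 / q" "0 \<le> 1 / (1 - q)" using q01 by auto
      then have "- 1 / (1 - q) \<le> 1 / q" "- 1 / q \<le> 1 / (1 - q)" by (simp_all add: order_trans[of _ 0])
      then show "\<sigma> * score q x \<in> {a..b}"
        using \<sigma>' by (cases x) (auto simp: a_def b_def sc)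
    qed
  qed simp
  have E0: "measure_pmf.expectation (bernoulli_pmf q) (\<lambda>x. \<sigma> * score q x) = 0"
    using q01 by (simp add: sc)
  have ba_eq: "b - a = 1 / q + 1 / (1 - q)" using \<sigma>' by (auto simp: a_def b_def)
  also have "\<dots> \<le> 1 / \<alpha> + 1 / \<alpha>"
    using q q01 pos by (intro add_mono divide_left_mono) auto
  finally have ba: "b - a \<le> 2 / \<alpha>" by simp
  have ba0: "0 \<le> b - a" unfolding ba_eq using q01 by simp
  have "(b - a)\<^sup>2 \<le> (2 / \<alpha>)\<^sup>2" using ba ba0 by (intro power_mono) auto
  then have "l\<^sup>2 * (b - a)\<^sup>2 / 8 \<le> l\<^sup>2 * (2 / \<alpha>)\<^sup>2 / 8"
    by (intro divide_right_mono mult_left_mono) auto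
  also have "\<dots> = l\<^sup>2 / (2 * \<alpha>\<^sup>2)" by (simp add: power_divide)
  finally have "exp (l\<^sup>2 * (b - a)\<^sup>2 / 8) \<le> exp (l\<^sup>2 / (2 * \<alpha>\<^sup>2))" by simp
  then show ?thesis
    using Hoeffdings_lemma_nn_integral_0[OF pos(2) E0] by (meson ennreal_leI order_trans)
qed

text \<open>A row mean is a sum of nonnegative entries; if it is not 0, it contains a nonzero entry,
  which is at least \<alpha>. As the row sums to 1, 1 minus the mean is the same kind of sum over
  the nodes of opinion 0.\<close>

lemma row_mean_gap:
  assumes A: "stochastic_mat n A" and u: "u < n"
    and \<alpha>: "\<And>v. v < n \<Longrightarrow> A $$ (u, v) \<noteq> 0 \<Longrightarrow> \<alpha> \<le> A $$ (u, v)"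
  shows "row_mean n A u x \<noteq> 0 \<Longrightarrow> \<alpha> \<le> row_mean n A u x"
    and "row_mean n A u x \<noteq> 1 \<Longrightarrow> \<alpha> \<le> 1 - row_mean n A u x"
proof -
  have C: "A \<in> carrier_mat n n" and nonneg: "\<And>v. v < n \<Longrightarrow> 0 \<le> A $$ (u, v)"
    and row: "(\<Sum>v<n. A $$ (u, v)) = 1"
    using A u by (auto simp: stochastic_mat_def)
  have gap: "\<alpha> \<le> (\<Sum>v<n. A $$ (u, v) * of_bool (Q v))" if nz: "(\<Sum>v<n. A $$ (u, v) * of_bool (Q v)) \<noteq> 0" for Q
  proof -
    obtain v where v: "v < n" "A $$ (u, v) * of_bool (Q v) \<noteq> 0"
      using nz by (meson lessThan_iff sum.neutral)
    then have "\<alpha> \<le> A $$ (u, v) * of_bool (Q v)" using \<alpha> by (auto split: if_splits)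
    also have "\<dots> \<le> (\<Sum>v<n. A $$ (u, v) * of_bool (Q v))"
      using v nonneg by (intro member_le_sum) auto
    finally show ?thesis .
  qed
  have c: "1 - row_mean n A u x = (\<Sum>v<n. A $$ (u, v) * of_bool (\<not> x v))"
  proof -
    have "(\<Sum>v<n. A $$ (u, v) * of_bool (x v)) + (\<Sum>v<n. A $$ (u, v) * of_bool (\<not> x v)) = (\<Sum>v<n. A $$ (u, v))"
      unfolding sum.distrib[symmetric] by (intro sum.cong) auto
    then show ?thesis unfolding row_mean_eq[OF C u] using row by linarith
  qed
  show "row_mean n A u x \<noteq> 0 \<Longrightarrow> \<alpha> \<le> row_mean n A u x"
    using gap[of x] by (simp add: row_mean_eq[OF C u])
  show "row_mean n A u x \<noteq> 1 \<Longrightarrow> \<alpha> \<le> 1 - row_mean n A u x"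
    using gap[of "\<lambda>v. \<not> x v"] unfolding c[symmetric] by simp
qed

section \<open>An exponential supermartingale for the gradient\<close>

lemma alive_cong: "(\<And>r. r \<le> t \<Longrightarrow> \<omega> r = \<omega>' r) \<Longrightarrow> alive n t \<omega> = alive n t \<omega>'"
  by (auto simp: alive_def)

context voter_model
begin

text \<open>Contribution of one path to entry (u, v) of the log-likelihood gradient at the true
  parameter, with the convention of \<open>score\<close> at the probabilities 0 and 1.\<close>

definition noise :: "nat \<Rightarrow> nat \<Rightarrow> (nat \<Rightarrow> state) \<Rightarrow> real" where
  "noise u v = path_sum n (\<lambda>t \<omega>. score (row_mean n A u (\<omega> t)) (\<omega> (Suc t) u) * of_bool (\<omega> t v))"

lemma score_measurable:
  "(\<lambda>\<omega>. score (row_mean n A u (\<omega> t)) (\<omega> (Suc t) u) * of_bool (\<omega> t v)) \<in> borel_measurable P"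
proof -
  have [measurable]: "(\<lambda>\<omega>. row_mean n A u (\<omega> t)) \<in> borel_measurable P"
    by (rule component_fun)
  have [measurable]: "(\<lambda>\<omega>. of_bool (\<omega> (Suc t) u) :: real) \<in> borel_measurable P"
    by (rule component_fun)
  have [measurable]: "(\<lambda>\<omega>. of_bool (\<omega> t v) :: real) \<in> borel_measurable P"
    by (rule component_fun)
  show ?thesis unfolding score_def by measurable
qed

lemma noise_measurable [measurable]: "noise u v \<in> borel_measurable P"
  unfolding noise_def by (intro path_sum_measurable score_measurable)

text \<open>Before consensus each step multiplies the conditional exponential moment by at most exp
  c with c = l^2 / (2 \<alpha>^2), and c is what is subtracted per unit of \<tau>. The compensated
  exponential is thus a supermartingale, and Fatou's lemma carries the bound 1 from fixed times to
  \<tau>.\<close>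

lemma nn_integral_exp_noise:
  assumes u: "u < n" and pos: "0 < \<alpha>" "0 < l" and \<sigma>: "\<bar>\<sigma>\<bar> = 1"
    and \<alpha>: "\<And>v. v < n \<Longrightarrow> A $$ (u, v) \<noteq> 0 \<Longrightarrow> \<alpha> \<le> A $$ (u, v)"
  shows "(\<integral>\<^sup>+\<omega>. ennreal (exp (l * (\<sigma> * noise u v \<omega>) - l\<^sup>2 / (2 * \<alpha>\<^sup>2) * tau n \<omega>)) \<partial>P) \<le> 1"
proof -
  define c where "c = l\<^sup>2 / (2 * \<alpha>\<^sup>2)"
  have c0: "0 \<le> c" by (simp add: c_def)
  \<comment> \<open>Increments are frozen at 0 from consensus on, so the partial sums are eventually
    constant on almost every path.\<close>
  define g :: "nat \<Rightarrow> (nat \<Rightarrow> state) \<Rightarrow> state \<Rightarrow> real" where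
    "g t \<omega> y = (if alive n t \<omega> then l * (\<sigma> * (score (row_mean n A u (\<omega> t)) (y u) * of_bool (\<omega> t v))) - c else 0)" for t \<omega> y
  define M :: "nat \<Rightarrow> (nat \<Rightarrow> state) \<Rightarrow> real" where "M N \<omega> = (\<Sum>t<N. g t \<omega> (\<omega> (Suc t)))" for N \<omega>
  have step: "(\<integral>\<^sup>+y. ennreal (exp (g t \<omega> y)) \<partial>measure_pmf (voter_step n A (\<omega> t))) \<le> 1"
    if x: "\<omega> t \<in> states n" for t \<omega>
  proof (cases "alive n t \<omega>")
    case False
    then show ?thesis by (simp add: g_def measure_pmf.emeasure_space_1[simplified])
  next
    case al: True
    show ?thesis
    proof (cases "\<omega> t v")
      case False
      \<comment> \<open>If v has opinion 0, the increment is just -c \<le> 0.\<close>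
      then have "(\<integral>\<^sup>+y. ennreal (exp (g t \<omega> y)) \<partial>measure_pmf (voter_step n A (\<omega> t)))
          \<le> (\<integral>\<^sup>+y. 1 \<partial>measure_pmf (voter_step n A (\<omega> t)))"
        using c0 by (intro nn_integral_mono) (simp add: g_def)
      then show ?thesis by (simp add: measure_pmf.emeasure_space_1[simplified])
    next
      case True
      let ?q = "row_mean n A u (\<omega> t)"
      have q: "0 \<le> ?q" "?q \<le> 1" using parameter_A x u by (auto simp: voter_parameter_def)
      have comp: "map_pmf (\<lambda>y. y u) (voter_step n A (\<omega> t)) = bernoulli_pmf ?q"
        using u by (simp add: voter_step_def Pi_pmf_component)
      have "(\<integral>\<^sup>+y. ennreal (exp (g t \<omega> y)) \<partial>measure_pmf (voter_step n A (\<omega> t)))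
          = (\<integral>\<^sup>+y. ennreal (exp (- c)) * ennreal (exp (l * (\<sigma> * score ?q (y u)))) \<partial>measure_pmf (voter_step n A (\<omega> t)))"
        using al True by (simp add: g_def ennreal_mult[symmetric] mult_exp_exp)
      also have "\<dots> = ennreal (exp (- c)) * (\<integral>\<^sup>+y. ennreal (exp (l * (\<sigma> * score ?q (y u)))) \<partial>measure_pmf (voter_step n A (\<omega> t)))"
        by (intro nn_integral_cmult) simp
      also have "(\<integral>\<^sup>+y. ennreal (exp (l * (\<sigma> * score ?q (y u)))) \<partial>measure_pmf (voter_step n A (\<omega> t)))
          = (\<integral>\<^sup>+b. ennreal (exp (l * (\<sigma> * score ?q b))) \<partial>measure_pmf (bernoulli_pmf ?q))"
        unfolding comp[symmetric] by (simp add: nn_integral_map_pmf)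
      also have "ennreal (exp (- c)) * \<dots> \<le> ennreal (exp (- c)) * ennreal (exp c)"
        unfolding c_def
        by (intro mult_left_mono nn_integral_exp_score_bernoulli q pos \<sigma> row_mean_gap[OF stoch u \<alpha>]) auto
      also have "\<dots> = 1" by (simp add: ennreal_mult[symmetric] mult_exp_exp)
      finally show ?thesis .
    qed
  qed
  have M_meas: "M N \<in> borel_measurable P" for N
  proof -
    note score_measurable[of u _ v, measurable]
    show ?thesis unfolding M_def[abs_def] g_def by measurable
  qed
  have le1: "(\<integral>\<^sup>+\<omega>. ennreal (exp (M N \<omega>)) \<partial>P) \<le> 1" for N
  proof (induction N)
    case 0
    then show ?case using emeasure_space_1 by (simp add: M_def)
  next
    case (Suc N)
    have "(\<integral>\<^sup>+\<omega>. ennreal (exp (M (Suc N) \<omega>)) \<partial>P) = (\<integral>\<^sup>+\<omega>. ennreal (exp (M N \<omega> + g N \<omega> (\<omega> (Suc N)))) \<partial>P)"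
      by (simp add: M_def)
    also have "\<dots> = (\<integral>\<^sup>+\<omega>. (\<integral>\<^sup>+y. ennreal (exp (M N \<omega> + g N \<omega> y)) \<partial>measure_pmf (voter_step n A (\<omega> N))) \<partial>P)"
    proof (rule nn_integral_Suc)
      fix \<omega> \<omega>' :: "nat \<Rightarrow> state" and y
      assume eq: "\<And>r. r \<le> N \<Longrightarrow> \<omega> r = \<omega>' r"
      have "alive n t \<omega> = alive n t \<omega>'" if "t \<le> N" for t
        using eq that by (intro alive_cong) auto
      then have "g t \<omega> z = g t \<omega>' z" if "t \<le> N" for t z
        using eq that by (simp add: g_def)
      moreover from this have "M N \<omega> = M N \<omega>'"
        unfolding M_def using eq by (intro sum.cong) auto
      ultimately show "ennreal (exp (M N \<omega> + g N \<omega> y)) = ennreal (exp (M N \<omega>' + g N \<omega>' y))" by simp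
    qed
    also have "\<dots> \<le> (\<integral>\<^sup>+\<omega>. ennreal (exp (M N \<omega>)) \<partial>P)"
    proof (rule nn_integral_mono_AE)
      show "AE \<omega> in P. (\<integral>\<^sup>+y. ennreal (exp (M N \<omega> + g N \<omega> y)) \<partial>measure_pmf (voter_step n A (\<omega> N)))
          \<le> ennreal (exp (M N \<omega>))"
        using AE_states
      proof eventually_elim
        case (elim \<omega>)
        have "(\<integral>\<^sup>+y. ennreal (exp (M N \<omega> + g N \<omega> y)) \<partial>measure_pmf (voter_step n A (\<omega> N)))
            = ennreal (exp (M N \<omega>)) * (\<integral>\<^sup>+y. ennreal (exp (g N \<omega> y)) \<partial>measure_pmf (voter_step n A (\<omega> N)))"
          by (subst nn_integral_cmult[symmetric]) (simp_all add: exp_add ennreal_mult)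
        also have "\<dots> \<le> ennreal (exp (M N \<omega>)) * 1"
          using elim by (intro mult_left_mono step) auto
        finally show ?case by simp
      qed
    qed
    finally show ?case using Suc by simp
  qed
  \<comment> \<open>The partial sums reach the stopped exponent at the consensus time, so the liminf
    in Fatou's lemma is the integrand of interest.\<close>
  have "(\<integral>\<^sup>+\<omega>. ennreal (exp (l * (\<sigma> * noise u v \<omega>) - c * tau n \<omega>)) \<partial>P)
      = (\<integral>\<^sup>+\<omega>. liminf (\<lambda>N. ennreal (exp (M N \<omega>))) \<partial>P)"
  proof (rule nn_integral_cong_AE)
    from AE_consensus_time show "AE \<omega> in P. ennreal (exp (l * (\<sigma> * noise u v \<omega>) - c * tau n \<omega>))
        = liminf (\<lambda>N. ennreal (exp (M N \<omega>)))"
    proof eventually_elim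
      case (elim \<omega>)
      then obtain k where k: "consensus_time n \<omega> = enat k" by auto
      have al: "alive n t \<omega> \<longleftrightarrow> t < k" for t by (simp flip: less_consensus_time_iff add: k)
      have "M N \<omega> = l * (\<sigma> * noise u v \<omega>) - c * tau n \<omega>" if "k \<le> N" for N
      proof -
        have "M N \<omega> = (\<Sum>t<k. g t \<omega> (\<omega> (Suc t)))"
          unfolding M_def using that by (intro sum.mono_neutral_right) (auto simp: g_def al)
        also have "\<dots> = (\<Sum>t<k. l * (\<sigma> * (score (row_mean n A u (\<omega> t)) (\<omega> (Suc t) u) * of_bool (\<omega> t v))) - c)"
          by (intro sum.cong) (auto simp: g_def al)
        also have "\<dots> = l * (\<sigma> * noise u v \<omega>) - c * tau n \<omega>"
          unfolding noise_def path_sum_enat[OF k] by (simp add: sum_subtractf sum_distrib_left del: sum_mult_of_bool_eq)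
        finally show ?thesis .
      qed
      then have "eventually (\<lambda>N. ennreal (exp (M N \<omega>)) = ennreal (exp (l * (\<sigma> * noise u v \<omega>) - c * tau n \<omega>))) sequentially"
        by (auto simp: eventually_sequentially)
      then have "(\<lambda>N. ennreal (exp (M N \<omega>))) \<longlonglongrightarrow> ennreal (exp (l * (\<sigma> * noise u v \<omega>) - c * tau n \<omega>))"
        by (rule tendsto_eventually)
      then show ?case by (rule lim_imp_Liminf[OF trivial_limit_sequentially, symmetric])
    qed
  qed
  also have "\<dots> \<le> liminf (\<lambda>N. \<integral>\<^sup>+\<omega>. ennreal (exp (M N \<omega>)) \<partial>P)"
    using M_meas by (intro nn_integral_liminf) auto
  also have "\<dots> \<le> liminf (\<lambda>N. 1)"
    using le1 by (intro Liminf_mono) auto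
  also have "\<dots> = 1" by (simp add: Liminf_const)
  finally show ?thesis by (simp add: c_def)
qed

end

section \<open>Independent observations\<close>

context prob_space
begin

text \<open>Markov's inequality for the exponential of the sum, whose mean factorises; the Chernoff
  parameter is part of f.\<close>

lemma PiM_Chernoff:
  fixes f :: "'a \<Rightarrow> real" and m :: nat
  assumes f [measurable]: "f \<in> borel_measurable M"
    and c: "(\<integral>\<^sup>+x. ennreal (exp (f x)) \<partial>M) \<le> ennreal c" "0 \<le> c"
  defines "Q \<equiv> (\<Pi>\<^sub>M i\<in>{..<m}. M)"
  shows "measure Q {X \<in> space Q. z \<le> (\<Sum>i<m. f (X i))} \<le> c ^ m * exp (- z)"
proof -
  interpret PP: product_prob_space "\<lambda>_::nat. M" "{..<m}" ..
  interpret Q: prob_space Q unfolding Q_def by (rule prob_space_PiM) (rule prob_space_axioms)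
  have [measurable]: "(\<lambda>X. \<Sum>i<m. f (X i)) \<in> borel_measurable Q"
    unfolding Q_def by measurable
  have "(\<integral>\<^sup>+X. ennreal (exp (\<Sum>i<m. f (X i))) \<partial>Q) = (\<integral>\<^sup>+X. (\<Prod>i<m. ennreal (exp (f (X i)))) \<partial>Q)"
    by (simp add: exp_sum prod_ennreal)
  also have "\<dots> = (\<Prod>i<m. \<integral>\<^sup>+x. ennreal (exp (f x)) \<partial>M)"
    unfolding Q_def by (rule PP.product_nn_integral_prod) auto
  also have "\<dots> \<le> (\<Prod>i<m. ennreal c)"
    using c by (intro prod_mono_ennreal) auto
  also have "\<dots> = ennreal (c ^ m)" using c by (simp add: ennreal_power)
  finally have I: "(\<integral>\<^sup>+X. ennreal (exp (\<Sum>i<m. f (X i))) \<partial>Q) \<le> ennreal (c ^ m)" .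
  have "emeasure Q {X \<in> space Q. z \<le> (\<Sum>i<m. f (X i))}
      = (\<integral>\<^sup>+X. indicator {X \<in> space Q. z \<le> (\<Sum>i<m. f (X i))} X \<partial>Q)"
    by simp
  also have "\<dots> \<le> (\<integral>\<^sup>+X. ennreal (exp (- z)) * ennreal (exp (\<Sum>i<m. f (X i))) \<partial>Q)"
    by (intro nn_integral_mono) (auto simp: ennreal_mult[symmetric] mult_exp_exp split: split_indicator)
  also have "\<dots> = ennreal (exp (- z)) * (\<integral>\<^sup>+X. ennreal (exp (\<Sum>i<m. f (X i))) \<partial>Q)"
    by (intro nn_integral_cmult) measurable
  also have "\<dots> \<le> ennreal (exp (- z)) * ennreal (c ^ m)"
    by (intro mult_left_mono I) simp
  also have "\<dots> = ennreal (c ^ m * exp (- z))"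
    using c by (simp add: ennreal_mult[symmetric] mult.commute)
  finally show ?thesis
    using c by (simp add: Q.emeasure_eq_measure)
qed

lemma PiM_second_moment:
  fixes f :: "'a \<Rightarrow> real" and m :: nat
  assumes f: "f \<in> borel_measurable M" "integrable M (\<lambda>x. (f x)\<^sup>2)" and mean: "(\<integral>x. f x \<partial>M) = 0"
  defines "Q \<equiv> (\<Pi>\<^sub>M i\<in>{..<m}. M)"
  shows "integrable Q (\<lambda>X. (\<Sum>i<m. f (X i))\<^sup>2)"
    and "(\<integral>X. (\<Sum>i<m. f (X i))\<^sup>2 \<partial>Q) = m * (\<integral>x. (f x)\<^sup>2 \<partial>M)"
proof -
  interpret PP: product_prob_space "\<lambda>_::nat. M" "{..<m}" ..
  have int_f: "integrable M f" by (rule square_integrable_imp_integrable[OF f])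
  \<comment> \<open>The product f (X i) * f (X j) is written as a product over all coordinates so
    that its integral factorises. For i = j both factors fall on one coordinate and give f^2;
    otherwise a factor of mean 0 remains.\<close>
  define F where "F = (\<lambda>(i::nat) (j::nat) (k::nat) x. (if k = i then f x else 1) * (if k = j then f x else 1))"
  have F_int: "integrable M (F i j k)" for i j k
    using f(2) int_f by (cases "k = i"; cases "k = j") (auto simp: F_def power2_eq_square)
  have F_prod: "(\<Prod>k<m. F i j k (X k)) = f (X i) * f (X j)" if "i < m" "j < m" for i j X
    using that by (simp add: F_def prod.distrib)
  have int2: "integrable Q (\<lambda>X. f (X i) * f (X j))" if "i < m" "j < m" for i j
    using PP.product_integrable_prod[of "{..<m}" "F i j"] F_int F_prod[OF that] by (simp add: Q_def)
  have val: "(\<integral>X. f (X i) * f (X j) \<partial>Q) = (if i = j then \<integral>x. (f x)\<^sup>2 \<partial>M else 0)"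
    if ij: "i < m" "j < m" for i j
  proof -
    have "(\<integral>X. f (X i) * f (X j) \<partial>Q) = (\<Prod>k<m. \<integral>x. F i j k x \<partial>M)"
      using PP.product_integral_prod[of "{..<m}" "F i j"] F_int F_prod[OF ij] by (simp add: Q_def)
    also have "\<dots> = (if i = j then \<integral>x. (f x)\<^sup>2 \<partial>M else 0)"
    proof (cases "i = j")
      case True
      have "(\<Prod>k<m. \<integral>x. F i j k x \<partial>M) = (\<Prod>k<m. if k = i then \<integral>x. (f x)\<^sup>2 \<partial>M else 1)"
        using True prob_space by (intro prod.cong) (auto simp: F_def power2_eq_square)
      then show ?thesis using True ij by simp
    next
      case False
      then have "(\<integral>x. F i j i x \<partial>M) = 0" using mean by (simp add: F_def)
      then show ?thesis using False ij by (auto intro!: prod_zero)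
    qed
    finally show ?thesis .
  qed
  have sq: "(\<Sum>i<m. f (X i))\<^sup>2 = (\<Sum>i<m. \<Sum>j<m. f (X i) * f (X j))" for X :: "nat \<Rightarrow> 'a"
    by (simp add: power2_eq_square sum_product)
  show "integrable Q (\<lambda>X. (\<Sum>i<m. f (X i))\<^sup>2)"
    unfolding sq by (intro Bochner_Integration.integrable_sum int2) auto
  have "(\<integral>X. (\<Sum>i<m. f (X i))\<^sup>2 \<partial>Q) = (\<Sum>i<m. \<integral>X. (\<Sum>j<m. f (X i) * f (X j)) \<partial>Q)"
    unfolding sq by (intro Bochner_Integration.integral_sum Bochner_Integration.integrable_sum int2) auto
  also have "\<dots> = (\<Sum>i<m. \<Sum>j<m. \<integral>X. f (X i) * f (X j) \<partial>Q)"
    by (intro sum.cong refl Bochner_Integration.integral_sum int2) auto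
  also have "\<dots> = m * (\<integral>x. (f x)\<^sup>2 \<partial>M)" by (simp add: val)
  finally show "(\<integral>X. (\<Sum>i<m. f (X i))\<^sup>2 \<partial>Q) = m * (\<integral>x. (f x)\<^sup>2 \<partial>M)" .
qed

end

context voter_model
begin

section \<open>Deviations of the Gram matrix and of the total length\<close>

definition gram :: "nat \<Rightarrow> nat \<Rightarrow> (nat \<Rightarrow> state) \<Rightarrow> real" where
  "gram v w = path_sum n (\<lambda>t \<omega>. of_bool (\<omega> t v) * of_bool (\<omega> t w))"

text \<open>Squared Frobenius distance of the summed Gram matrix from its mean. It controls the
  quadratic form in all directions at once, and its mean is a sum of variances.\<close>

definition gram_error :: "nat \<Rightarrow> (nat \<Rightarrow> nat \<Rightarrow> state) \<Rightarrow> real" where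
  "gram_error m X = (\<Sum>v<n. \<Sum>w<n. (\<Sum>i<m. gram v w (X i) - expectation (gram v w))\<^sup>2)"

text \<open>First factor under the root in \<open>cn\<close>; \<open>log_scale / \<Phi>\<close> is
  the length allotted to a path on average.\<close>

definition log_scale :: real where "log_scale = ln B + ln (2 * real n ^ 3)"

lemma gram_measurable [measurable]: "gram v w \<in> borel_measurable P"
  unfolding gram_def
proof (rule path_sum_measurable)
  show "(\<lambda>\<omega>. of_bool (\<omega> t v) * of_bool (\<omega> t w) :: real) \<in> borel_measurable P" for t
    by (rule component_fun)
qed

lemma gram_le_tau: "\<bar>gram v w \<omega>\<bar> \<le> tau n \<omega>"
  unfolding gram_def path_sum_def by (intro order_trans[OF sum_abs] sum_mono) auto

lemma gram_variance:
  "integrable P (\<lambda>\<omega>. (gram v w \<omega> - expectation (gram v w))\<^sup>2)"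
  "(\<integral>\<omega>. (gram v w \<omega> - expectation (gram v w))\<^sup>2 \<partial>P) \<le> 48 * B / \<Phi>\<^sup>2"
proof -
  note g = square_integrable_le_tau[OF gram_measurable gram_le_tau, of v w]
  have "(gram v w \<omega> - expectation (gram v w))\<^sup>2
      = (gram v w \<omega>)\<^sup>2 - 2 * expectation (gram v w) * gram v w \<omega> + (expectation (gram v w))\<^sup>2" for \<omega>
    by (simp add: power2_diff)
  then show "integrable P (\<lambda>\<omega>. (gram v w \<omega> - expectation (gram v w))\<^sup>2)"
    using g by simp
  have "variance (gram v w) = (\<integral>\<omega>. (gram v w \<omega>)\<^sup>2 \<partial>P) - (expectation (gram v w))\<^sup>2"
    by (rule variance_eq) (use g in auto)
  also have "\<dots> \<le> 48 * B / \<Phi>\<^sup>2" using g(3) zero_le_power2[of "expectation (gram v w)"] by linarith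
  finally show "(\<integral>\<omega>. (gram v w \<omega> - expectation (gram v w))\<^sup>2 \<partial>P) \<le> 48 * B / \<Phi>\<^sup>2" .
qed

text \<open>Markov's inequality for the squared error: there are n^2 entries, and by independence
  each contributes m single-path variances.\<close>

lemma prob_gram_error:
  fixes m :: nat
  defines "Q \<equiv> (\<Pi>\<^sub>M i\<in>{..<m}. P)"
  assumes z: "0 < z"
  shows "measure Q {X \<in> space Q. z \<le> gram_error m X} \<le> real n ^ 2 * (m * (48 * B / \<Phi>\<^sup>2)) / z"
    and "gram_error m \<in> borel_measurable Q"
proof -
  interpret Q: prob_space Q unfolding Q_def by (rule prob_space_PiM) (rule prob_space_axioms)
  show meas: "gram_error m \<in> borel_measurable Q"
    unfolding gram_error_def[abs_def] Q_def by measurable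
  have mean: "(\<integral>\<omega>. gram v w \<omega> - expectation (gram v w) \<partial>P) = 0" for v w
    using square_integrable_le_tau(2)[OF gram_measurable gram_le_tau, of v w] prob_space by simp
  have sm: "integrable Q (\<lambda>X. (\<Sum>i<m. gram v w (X i) - expectation (gram v w))\<^sup>2)"
    "(\<integral>X. (\<Sum>i<m. gram v w (X i) - expectation (gram v w))\<^sup>2 \<partial>Q)
       = m * (\<integral>\<omega>. (gram v w \<omega> - expectation (gram v w))\<^sup>2 \<partial>P)" for v w
    using PiM_second_moment[OF _ gram_variance(1) mean, of v w m] by (simp_all add: Q_def)
  have int: "integrable Q (gram_error m)"
    unfolding gram_error_def[abs_def] by (intro Bochner_Integration.integrable_sum sm)
  have "(\<integral>X. gram_error m X \<partial>Q) = (\<Sum>v<n. \<Sum>w<n. m * (\<integral>\<omega>. (gram v w \<omega> - expectation (gram v w))\<^sup>2 \<partial>P))"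
    unfolding gram_error_def by (simp add: sm Bochner_Integration.integral_sum Bochner_Integration.integrable_sum)
  also have "\<dots> \<le> (\<Sum>v<n. \<Sum>w<n. m * (48 * B / \<Phi>\<^sup>2))"
    by (intro sum_mono mult_left_mono gram_variance) auto
  finally have le: "(\<integral>X. gram_error m X \<partial>Q) \<le> real n ^ 2 * (m * (48 * B / \<Phi>\<^sup>2))"
    by (simp add: power2_eq_square)
  have "measure Q {X \<in> space Q. z \<le> gram_error m X} \<le> (\<integral>X. gram_error m X \<partial>Q) / z"
    by (rule integral_Markov_inequality_measure[OF int, of "{}"])
       (use z in \<open>auto simp: gram_error_def intro!: sum_nonneg\<close>)
  also have "\<dots> \<le> real n ^ 2 * (m * (48 * B / \<Phi>\<^sup>2)) / z"
    using le z by (intro divide_right_mono) auto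
  finally show "measure Q {X \<in> space Q. z \<le> gram_error m X} \<le> real n ^ 2 * (m * (48 * B / \<Phi>\<^sup>2)) / z" .
qed

text \<open>Chernoff bound with exponent \<Phi> / 2. \<open>log_scale\<close> is chosen so that B
  cancels: each path contributes the factor 6 * sqrt B * exp (- log_scale / 2) = 6 / sqrt (2
  n^3).\<close>

lemma prob_tau_sum:
  fixes m :: nat
  defines "Q \<equiv> (\<Pi>\<^sub>M i\<in>{..<m}. P)"
  assumes n5: "5 \<le> n" and m: "0 < m"
  shows "measure Q {X \<in> space Q. m * (log_scale / \<Phi>) \<le> (\<Sum>i<m. tau n (X i))} \<le> 2 / n"
proof -
  have "measure Q {X \<in> space Q. m * (log_scale / 2) \<le> (\<Sum>i<m. \<Phi> / 2 * tau n (X i))}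
      \<le> (6 * sqrt B) ^ m * exp (- (m * (log_scale / 2)))"
    unfolding Q_def using B_ge by (intro PiM_Chernoff nn_integral_exp_tau) auto
  also have "(\<lambda>X. m * (log_scale / 2) \<le> (\<Sum>i<m. \<Phi> / 2 * tau n (X i)))
      = (\<lambda>X. m * (log_scale / \<Phi>) \<le> (\<Sum>i<m. tau n (X i)))"
    unfolding sum_distrib_left[symmetric] using Phi_pos by (auto simp: field_simps)
  also have "(6 * sqrt B) ^ m * exp (- (m * (log_scale / 2))) = (6 * sqrt B * exp (- (log_scale / 2))) ^ m"
    by (simp add: power_mult_distrib exp_of_nat_mult[symmetric])
  also have "exp (- (log_scale / 2)) = inverse (sqrt B * sqrt (2 * real n ^ 3))"
  proof -
    have "log_scale / 2 = ln (sqrt B) + ln (sqrt (2 * real n ^ 3))"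
      using B_ge n2 by (simp add: log_scale_def ln_sqrt add_divide_distrib)
    then have "exp (log_scale / 2) = exp (ln (sqrt B)) * exp (ln (sqrt (2 * real n ^ 3)))"
      by (simp only: exp_add)
    then have "exp (log_scale / 2) = sqrt B * sqrt (2 * real n ^ 3)"
      using B_ge n2 by simp
    then show ?thesis by (simp add: exp_minus)
  qed
  also have "6 * sqrt B * inverse (sqrt B * sqrt (2 * real n ^ 3)) = 6 / sqrt (2 * real n ^ 3)"
    using B_ge by (simp add: field_simps)
  also have "(6 / sqrt (2 * real n ^ 3)) ^ m \<le> (2 / n) ^ m"
  proof (intro power_mono)
    \<comment> \<open>Here n \<ge> 5 enters, through 9 \<le> 2 n. The factor per path is then at
      most 2/n < 1, and so is its m-th power.\<close>
    have "3 * real n \<le> sqrt (2 * real n ^ 3)"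
    proof (rule real_le_rsqrt)
      have "9 * (real n)\<^sup>2 \<le> (2 * real n) * (real n)\<^sup>2"
        using n5 by (intro mult_right_mono) auto
      then show "(3 * real n)\<^sup>2 \<le> 2 * real n ^ 3"
        by (simp add: power2_eq_square power3_eq_cube)
    qed
    then have "6 / sqrt (2 * real n ^ 3) \<le> 6 / (3 * real n)"
      using n5 by (intro divide_left_mono) auto
    then show "6 / sqrt (2 * real n ^ 3) \<le> 2 / n" by simp
  qed simp
  also have "(2 / real n) ^ m \<le> (2 / n) ^ 1"
    using n5 m by (intro power_decreasing) auto
  finally show ?thesis by simp
qed

lemma prob_noise:
  fixes m :: nat
  defines "Q \<equiv> (\<Pi>\<^sub>M i\<in>{..<m}. P)"
  assumes u: "u < n" and pos: "0 < \<alpha>" "0 < l" and \<sigma>: "\<bar>\<sigma>\<bar> = 1"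
    and \<alpha>: "\<And>v. v < n \<Longrightarrow> A $$ (u, v) \<noteq> 0 \<Longrightarrow> \<alpha> \<le> A $$ (u, v)"
  shows "measure Q {X \<in> space Q. z \<le> (\<Sum>i<m. l * (\<sigma> * noise u v (X i)) - l\<^sup>2 / (2 * \<alpha>\<^sup>2) * tau n (X i))}
           \<le> exp (- z)"
  using PiM_Chernoff[OF _ order_trans[OF nn_integral_exp_noise[OF u pos \<sigma> \<alpha>]], of v 1 m z]
  by (simp add: Q_def)

end

section \<open>The penalised estimator\<close>

context voter_model
begin

section \<open>Error bound on a good event, and its probability\<close>

lemma correlation_mat_entry:
  assumes "v < n" "w < n"
  shows "correlation_mat n P $$ (v, w) = expectation (gram v w) / expected_consensus_time n P"
  using assms by (simp add: correlation_mat_def gram_def path_sum_def[abs_def] state_vec_def)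

text \<open>The mean of the Gram sum contributes at least \<kappa> D by the eigenvalue bound.
  Cauchy-Schwarz over index pairs, applied to d_v d_w and Z, bounds the deviation by D times the
  Frobenius norm of Z, which the hypothesis on \<open>gram_error\<close> keeps at most \<kappa> D /
  2.\<close>

lemma gram_quadratic_form_ge:
  fixes d :: "nat \<Rightarrow> real"
  assumes err: "gram_error m X < (m * expected_consensus_time n P * lambda_min (correlation_mat n P) / 2)\<^sup>2"
    and lam: "0 < lambda_min (correlation_mat n P)"
  shows "m * expected_consensus_time n P * lambda_min (correlation_mat n P) / 2 * (\<Sum>v<n. (d v)\<^sup>2)
           \<le> (\<Sum>i<m. path_sum n (\<lambda>t \<omega>. (\<Sum>v<n. d v * of_bool (\<omega> t v))\<^sup>2) (X i))"
proof -
  let ?T = "expected_consensus_time n P"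
  let ?C = "correlation_mat n P"
  define \<kappa> where "\<kappa> = m * ?T * lambda_min ?C"
  have T: "1 \<le> ?T" by (rule expected_consensus_time_ge_1)
  define D where "D = (\<Sum>v<n. (d v)\<^sup>2)"
  define Z where "Z v w = (\<Sum>i<m. gram v w (X i) - expectation (gram v w))" for v w
  have \<kappa>0: "0 \<le> \<kappa>" using T lam by (simp add: \<kappa>_def)
  have D0: "0 \<le> D" by (simp add: D_def sum_nonneg)
  have expand: "path_sum n (\<lambda>t \<omega>. (\<Sum>v<n. d v * of_bool (\<omega> t v))\<^sup>2) \<omega>
      = (\<Sum>v<n. \<Sum>w<n. d v * d w * gram v w \<omega>)" for \<omega>
  proof -
    have "(\<Sum>v<n. d v * of_bool (\<omega> t v))\<^sup>2
        = (\<Sum>v<n. \<Sum>w<n. d v * d w * (of_bool (\<omega> t v) * of_bool (\<omega> t w)))" for t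
      unfolding power2_eq_square sum_product by (intro sum.cong refl) (simp only: mult_ac)
    then show ?thesis
      unfolding path_sum_def gram_def
      by (simp only: sum_distrib_left) (rule trans[OF sum.swap], intro sum.cong refl sum.swap)
  qed
  have "lambda_min ?C * D \<le> (\<Sum>v<n. \<Sum>w<n. d v * ?C $$ (v, w) * d w)"
    unfolding D_def
    by (rule lambda_min_le_quadratic_form)
       (auto simp: correlation_mat_def mult.commute)
  also have "\<dots> = (\<Sum>v<n. \<Sum>w<n. d v * d w * expectation (gram v w)) / ?T"
    by (simp add: correlation_mat_entry sum_divide_distrib mult_ac)
  finally have "lambda_min ?C * D * ?T \<le> (\<Sum>v<n. \<Sum>w<n. d v * d w * expectation (gram v w))"
    using T by (simp add: pos_le_divide_eq)
  then have mean: "\<kappa> * D \<le> m * (\<Sum>v<n. \<Sum>w<n. d v * d w * expectation (gram v w))"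
    using mult_left_mono[of _ _ "real m"] by (fastforce simp: \<kappa>_def mult_ac)
  have "(\<Sum>v<n. \<Sum>w<n. d v * d w * Z v w)\<^sup>2
      = (\<Sum>p\<in>{..<n} \<times> {..<n}. (d (fst p) * d (snd p)) * Z (fst p) (snd p))\<^sup>2"
    by (simp add: sum.cartesian_product case_prod_unfold)
  also have "\<dots> \<le> (\<Sum>p\<in>{..<n} \<times> {..<n}. (d (fst p) * d (snd p))\<^sup>2) * (\<Sum>p\<in>{..<n} \<times> {..<n}. (Z (fst p) (snd p))\<^sup>2)"
    by (rule Cauchy_Schwarz_ineq_sum)
  also have "(\<Sum>p\<in>{..<n} \<times> {..<n}. (d (fst p) * d (snd p))\<^sup>2) = D\<^sup>2"
    by (simp add: D_def power2_eq_square[of "sum _ _"] sum_product sum.cartesian_product case_prod_unfold power_mult_distrib)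
  also have "(\<Sum>p\<in>{..<n} \<times> {..<n}. (Z (fst p) (snd p))\<^sup>2) = gram_error m X"
    by (simp add: gram_error_def Z_def sum.cartesian_product case_prod_unfold)
  also have "D\<^sup>2 * gram_error m X \<le> D\<^sup>2 * (\<kappa> / 2)\<^sup>2"
    using err by (intro mult_left_mono) (auto simp: \<kappa>_def)
  finally have "(\<Sum>v<n. \<Sum>w<n. d v * d w * Z v w)\<^sup>2 \<le> (D * (\<kappa> / 2))\<^sup>2"
    by (simp only: power_mult_distrib)
  then have "\<bar>\<Sum>v<n. \<Sum>w<n. d v * d w * Z v w\<bar> \<le> D * (\<kappa> / 2)"
    using D0 \<kappa>0 by (simp add: abs_le_square_iff[symmetric])
  then have dev: "- (\<kappa> / 2 * D) \<le> (\<Sum>v<n. \<Sum>w<n. d v * d w * Z v w)"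
    by (simp add: abs_le_iff mult.commute)
  have "(\<Sum>i<m. path_sum n (\<lambda>t \<omega>. (\<Sum>v<n. d v * of_bool (\<omega> t v))\<^sup>2) (X i))
      = (\<Sum>v<n. \<Sum>w<n. d v * d w * (\<Sum>i<m. gram v w (X i)))"
    unfolding expand sum_distrib_left by (rule trans[OF sum.swap]) (intro sum.cong refl sum.swap)
  also have "\<dots> = (\<Sum>v<n. \<Sum>w<n. d v * d w * Z v w) + m * (\<Sum>v<n. \<Sum>w<n. d v * d w * expectation (gram v w))"
    by (simp add: Z_def sum_subtractf right_diff_distrib sum_distrib_left mult_ac)
  finally have "(\<Sum>i<m. path_sum n (\<lambda>t \<omega>. (\<Sum>v<n. d v * of_bool (\<omega> t v))\<^sup>2) (X i))
      = (\<Sum>v<n. \<Sum>w<n. d v * d w * Z v w) + m * (\<Sum>v<n. \<Sum>w<n. d v * d w * expectation (gram v w))" .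
  then show ?thesis
    using dev mean unfolding \<kappa>_def[symmetric] D_def[symmetric] by linarith
qed

text \<open>Deterministic core. The quadratic term splits over the rows u, all of which share one
  Gram matrix, so one estimate of that matrix serves every row. The constant is 36 = 9 * 4 because
  \<open>lasso_bound\<close> is applied with half of m T lam.\<close>

lemma penalized_estimator_error:
  assumes adm: "\<And>i. i < m \<Longrightarrow> admissible_path n A \<mu> (X i)"
    and noise: "\<And>u v. u < n \<Longrightarrow> v < n \<Longrightarrow> \<bar>\<Sum>i<m. noise u v (X i)\<bar> \<le> reg / 2"
    and err: "gram_error m X < (m * expected_consensus_time n P * lambda_min (correlation_mat n P) / 2)\<^sup>2"
    and lam: "0 < lambda_min (correlation_mat n P)" and m: "0 < m" and reg: "0 \<le> reg"
    and Ah: "voter_parameter n Ah" and min: "\<not> loss n m \<mu> reg X A < loss n m \<mu> reg X Ah"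
  shows "(frobenius_norm (Ah - A))\<^sup>2 \<le> 36 * reg\<^sup>2 * real (card (mat_support A))
           / (m * expected_consensus_time n P * lambda_min (correlation_mat n P))\<^sup>2"
proof -
  let ?T = "expected_consensus_time n P"
  let ?q = "\<lambda>u x. row_mean n A u x"
  define \<kappa> where "\<kappa> = m * ?T * lambda_min (correlation_mat n P) / 2"
  have \<kappa>: "0 < \<kappa>" using lam m expected_consensus_time_ge_1 by (simp add: \<kappa>_def)
  have Ah_carrier: "Ah \<in> carrier_mat n n" using Ah by (simp add: voter_parameter_def)
  define d where "d u v = Ah $$ (u, v) - A $$ (u, v)" for u v
  define g where "g u v = (\<Sum>i<m. noise u v (X i))" for u v
  have \<Delta>: "row_mean n Ah u x - ?q u x = (\<Sum>v<n. d u v * of_bool (x v))" if "u < n" for u x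
    unfolding row_mean_eq[OF Ah_carrier that] row_mean_eq[OF carrier_A that] d_def
    by (simp only: left_diff_distrib sum_subtractf)
  have F: "(frobenius_norm (Ah - A))\<^sup>2 = (\<Sum>u<n. \<Sum>v<n. (d u v)\<^sup>2)"
    using Ah_carrier carrier_A by (simp add: frobenius_norm_def d_def sum_nonneg)
  have noise_sum: "(\<Sum>i<m. path_sum n (\<lambda>t \<omega>. score (?q u (\<omega> t)) (\<omega> (Suc t) u) * (\<Sum>v<n. d u v * of_bool (\<omega> t v))) (X i))
      = (\<Sum>v<n. g u v * d u v)" for u
  proof -
    have "path_sum n (\<lambda>t \<omega>. score (?q u (\<omega> t)) (\<omega> (Suc t) u) * (\<Sum>v<n. d u v * of_bool (\<omega> t v))) \<omega>
        = (\<Sum>v<n. noise u v \<omega> * d u v)" for \<omega>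
      unfolding path_sum_def noise_def sum_distrib_left sum_distrib_right
      by (subst sum.swap) (simp only: mult_ac)
    then show ?thesis
      unfolding g_def sum_distrib_right by (simp only:) (rule sum.swap)
  qed
  let ?Q = "\<lambda>u i. path_sum n (\<lambda>t \<omega>. (\<Sum>v<n. d u v * of_bool (\<omega> t v))\<^sup>2) (X i)"
  let ?N = "\<lambda>u i. path_sum n (\<lambda>t \<omega>. score (?q u (\<omega> t)) (\<omega> (Suc t) u) * (\<Sum>v<n. d u v * of_bool (\<omega> t v))) (X i)"
  have "(\<Sum>i<m. \<Sum>u<n. ?Q u i / 2 - ?N u i) + reg * (norm_1_1 Ah - norm_1_1 A) \<le> 0"
    using loss_basic_inequality[OF parameter_A Ah adm min]
    by (simp add: path_sum_def \<Delta> sum_subtractf sum_divide_distrib del: sum_mult_of_bool_eq sum_of_bool_mult_eq)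
  also have "(\<Sum>i<m. \<Sum>u<n. ?Q u i / 2 - ?N u i) = (\<Sum>u<n. (\<Sum>i<m. ?Q u i) / 2 - (\<Sum>i<m. ?N u i))"
    by (subst sum.swap) (simp only: sum_subtractf sum_divide_distrib)
  also have "\<dots> = (\<Sum>u<n. (\<Sum>i<m. ?Q u i) / 2) - (\<Sum>u<n. \<Sum>v<n. g u v * d u v)"
    by (simp only: noise_sum sum_subtractf)
  finally have 1: "(\<Sum>u<n. (\<Sum>i<m. ?Q u i) / 2) - (\<Sum>u<n. \<Sum>v<n. g u v * d u v)
      + reg * (norm_1_1 Ah - norm_1_1 A) \<le> 0" .
  have 2: "\<kappa> / 2 * (\<Sum>u<n. \<Sum>v<n. (d u v)\<^sup>2) \<le> (\<Sum>u<n. (\<Sum>i<m. ?Q u i) / 2)"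
    unfolding sum_distrib_left
  proof (intro sum_mono)
    fix u
    show "(\<Sum>v<n. \<kappa> / 2 * (d u v)\<^sup>2) \<le> (\<Sum>i<m. ?Q u i) / 2"
      using gram_quadratic_form_ge[OF err lam, of "d u"]
      unfolding \<kappa>_def[symmetric] sum_distrib_left[symmetric] by linarith
  qed
  have norms: "norm_1_1 Ah = (\<Sum>u<n. \<Sum>v<n. \<bar>Ah $$ (u, v)\<bar>)" "norm_1_1 A = (\<Sum>u<n. \<Sum>v<n. \<bar>A $$ (u, v)\<bar>)"
    using Ah_carrier carrier_A by (simp_all add: norm_1_1_def)
  have supp: "mat_support A = {(u, v). u < n \<and> v < n \<and> A $$ (u, v) \<noteq> 0}"
    using carrier_A by (simp add: mat_support_def)
  have "(\<Sum>u<n. \<Sum>v<n. (Ah $$ (u, v) - A $$ (u, v))\<^sup>2)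
      \<le> 9 * reg\<^sup>2 * real (card {(u, v). u < n \<and> v < n \<and> A $$ (u, v) \<noteq> 0}) / \<kappa>\<^sup>2"
  proof (rule lasso_bound[where g = g])
    show "\<kappa> / 2 * (\<Sum>u<n. \<Sum>v<n. (Ah $$ (u, v) - A $$ (u, v))\<^sup>2)
        - (\<Sum>u<n. \<Sum>v<n. g u v * (Ah $$ (u, v) - A $$ (u, v)))
        + reg * ((\<Sum>u<n. \<Sum>v<n. \<bar>Ah $$ (u, v)\<bar>) - (\<Sum>u<n. \<Sum>v<n. \<bar>A $$ (u, v)\<bar>)) \<le> 0"
      using 1 2 unfolding norms d_def by linarith
    show "\<bar>g u v\<bar> \<le> reg / 2" if "u < n" "v < n" for u v
      using noise[OF that] by (simp add: g_def)
  qed (use \<kappa> reg in auto)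
  then show ?thesis
    unfolding F d_def supp by (simp add: \<kappa>_def power_divide field_simps)
qed

text \<open>The failure probabilities are 2/n for the total length, 1/n for the gradient, 1/n for
  the Gram matrix and 0 for inadmissible paths, which stays within 5/n.\<close>

lemma good_event:
  fixes m :: nat and T lam \<alpha> :: real
  defines "Q \<equiv> (\<Pi>\<^sub>M i\<in>{..<m}. P)"
  assumes n5: "5 \<le> n" and m: "0 < m" and \<alpha>0: "0 < \<alpha>"
    and \<alpha>: "\<And>u v. u < n \<Longrightarrow> v < n \<Longrightarrow> A $$ (u, v) \<noteq> 0 \<Longrightarrow> \<alpha> \<le> A $$ (u, v)"
    and lam: "0 < lam"
    and large: "96 * real n ^ 3 * (1 / pmin) * (1 / ((\<Phi> * T)\<^sup>2 * lam\<^sup>2)) \<le> m" and T: "0 < T"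
  obtains E where "E \<in> sets Q" "1 - 5 / real n \<le> measure Q E"
    "\<And>X i. X \<in> E \<Longrightarrow> i < m \<Longrightarrow> admissible_path n A \<mu> (X i)"
    "\<And>X u v. X \<in> E \<Longrightarrow> u < n \<Longrightarrow> v < n \<Longrightarrow>
       \<bar>\<Sum>i<m. noise u v (X i)\<bar> \<le> sqrt (2 * (m * (log_scale / \<Phi>)) * ln (4 * real n ^ 3)) / \<alpha>"
    "\<And>X. X \<in> E \<Longrightarrow> gram_error m X < (m * T * lam / 2)\<^sup>2"
proof -
  interpret Q: prob_space Q unfolding Q_def by (rule prob_space_PiM) (rule prob_space_axioms)
  define L where "L = ln (4 * real n ^ 3)"
  define K where "K = m * (log_scale / \<Phi>)"
  define z where "z = (m * T * lam / 2)\<^sup>2"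
  have n3: "1 \<le> real n ^ 3" using n2 by (intro one_le_power) auto
  have L0: "0 < L" unfolding L_def using n3 by (intro ln_gt_zero) linarith
  have "0 < log_scale"
    unfolding log_scale_def using n3 B_ge by (intro add_nonneg_pos) (auto simp: ln_gt_zero)
  then have K0: "0 < K" using m Phi_pos by (simp add: K_def)
  \<comment> \<open>The optimal exponent \<alpha> sqrt (2 L / K): at the threshold the linear term
    is 2 L and the compensator is L, which leaves L.\<close>
  define l where "l = sqrt (2 * K * L) * \<alpha> / K"
  have l0: "0 < l" using K0 L0 \<alpha>0 by (simp add: l_def)
  have l_eq: "l * (sqrt (2 * K * L) / \<alpha>) - l\<^sup>2 / (2 * \<alpha>\<^sup>2) * K = L"
  proof -
    have s: "(sqrt (2 * K * L))\<^sup>2 = 2 * K * L" using K0 L0 by simp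
    have "l * (sqrt (2 * K * L) / \<alpha>) = (sqrt (2 * K * L))\<^sup>2 / K"
      using \<alpha>0 by (simp add: l_def power2_eq_square)
    moreover have "l\<^sup>2 / (2 * \<alpha>\<^sup>2) * K = (sqrt (2 * K * L))\<^sup>2 / (2 * K)"
      using \<alpha>0 K0 by (simp add: l_def power_mult_distrib power_divide power2_eq_square)
    ultimately show ?thesis unfolding s using K0 by simp
  qed
  define G where "G u v \<sigma> = {X \<in> space Q. L \<le> (\<Sum>i<m. l * (\<sigma> * noise u v (X i)) - l\<^sup>2 / (2 * \<alpha>\<^sup>2) * tau n (X i))}"
    for u v and \<sigma> :: real
  define I where "I = {..<n} \<times> {..<n} \<times> {1, -1 :: real}"
  define Gs where "Gs = (\<Union>(u, v, \<sigma>)\<in>I. G u v \<sigma>)"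
  define E1 where "E1 = {X \<in> space Q. K \<le> (\<Sum>i<m. tau n (X i))}"
  define E2 where "E2 = {X \<in> space Q. z \<le> gram_error m X}"
  have z0: "0 < z" using m T lam by (simp add: z_def)
  have [measurable]: "gram_error m \<in> borel_measurable Q" unfolding Q_def by (rule prob_gram_error(2)[OF z0])
  have G_sets: "G u v \<sigma> \<in> sets Q" for u v \<sigma>
    unfolding G_def Q_def by measurable
  have E1_sets: "E1 \<in> sets Q" unfolding E1_def Q_def by measurable
  have E2_sets: "E2 \<in> sets Q" unfolding E2_def by measurable
  have fin_I: "finite I" by (simp add: I_def)
  have Gs_sets: "Gs \<in> sets Q" unfolding Gs_def using fin_I G_sets by (auto intro!: sets.finite_UN)
  have p1: "measure Q E1 \<le> 2 / n"
    unfolding E1_def K_def Q_def by (rule prob_tau_sum[OF n5 m])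
  have pG: "measure Q (G u v \<sigma>) \<le> 1 / (4 * real n ^ 3)" if "(u, v, \<sigma>) \<in> I" for u v \<sigma>
  proof -
    have "measure Q (G u v \<sigma>) \<le> exp (- L)"
      unfolding G_def Q_def using that by (intro prob_noise \<alpha>0 l0 \<alpha>) (auto simp: I_def)
    also have "\<dots> = 1 / (4 * real n ^ 3)"
      unfolding L_def using n2 by (simp add: exp_minus inverse_eq_divide)
    finally show ?thesis .
  qed
  \<comment> \<open>There are 2 n^2 triples (u, v, \<sigma>), each of probability at most exp (- L)
    = 1 / (4 n^3).\<close>
  have pGs: "measure Q Gs \<le> 1 / n"
  proof -
    have "measure Q Gs \<le> (\<Sum>p\<in>I. measure Q (case p of (u, v, \<sigma>) \<Rightarrow> G u v \<sigma>))"
      unfolding Gs_def using G_sets by (intro Q.finite_measure_subadditive_finite fin_I) auto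
    also have "\<dots> \<le> (\<Sum>p\<in>I. 1 / (4 * real n ^ 3))"
      using pG by (intro sum_mono) auto
    also have "\<dots> = (real n * (real n * 2)) * (1 / (4 * real n ^ 3))"
      by (simp add: I_def card_cartesian_product)
    also have "\<dots> = 1 / (2 * n)"
      using n2 by (simp add: power3_eq_cube field_simps)
    also have "\<dots> \<le> 1 / n"
      using n2 by (simp add: field_simps)
    finally show ?thesis .
  qed
  have p2: "measure Q E2 \<le> 1 / n"
  proof -
    have "measure Q E2 \<le> real n ^ 2 * (m * (48 * B / \<Phi>\<^sup>2)) / z"
      unfolding E2_def Q_def by (rule prob_gram_error(1)[OF z0])
    \<comment> \<open>96 = 48 * 4 / 2, with 4 from the halving in z and 1/2 from B. Of the n^3 in
      the sample size condition, n^2 pays for the matrix entries and n for the probability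
      1/n.\<close>
    also have "\<dots> = 96 * real n ^ 3 * (1 / pmin) * (1 / ((\<Phi> * T)\<^sup>2 * lam\<^sup>2)) / m / n"
      using m n2 Phi_pos T lam pmin_pos
      by (simp add: z_def B_def power_mult_distrib power_divide power2_eq_square power3_eq_cube field_simps)
    also have "\<dots> \<le> m / m / n"
      using large by (intro divide_right_mono) auto
    finally show ?thesis using m by simp
  qed
  \<comment> \<open>Admissibility is available only almost surely, so a measurable null set covering
    the exceptional paths is removed.\<close>
  obtain N where N: "{\<omega> \<in> space P. \<not> admissible_path n A \<mu> \<omega>} \<subseteq> N" "emeasure P N = 0" "N \<in> sets P"
    by (rule AE_E[OF AE_admissible])
  have AE_N: "AE X in Q. \<forall>i\<in>{..<m}. X i \<notin> N"
  proof (intro AE_finite_allI)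
    fix i assume "i \<in> {..<m}"
    moreover have "AE \<omega> in P. \<omega> \<notin> N" using N by (intro AE_not_in) auto
    ultimately show "AE X in Q. X i \<notin> N"
      unfolding Q_def using prob_space_axioms by (intro AE_PiM_component) auto
  qed simp
  define E0 where "E0 = {X \<in> space Q. \<exists>i\<in>{..<m}. X i \<in> N}"
  have E0_sets: "E0 \<in> sets Q" unfolding E0_def Q_def using N(3) by measurable
  have p0: "measure Q E0 = 0"
  proof -
    have "AE X in Q. X \<notin> E0" using AE_N by eventually_elim (auto simp: E0_def)
    then have "emeasure Q E0 = 0" using E0_sets by (simp add: AE_iff_null_sets null_setsD1)
    then show ?thesis by (simp add: measure_def)
  qed
  let ?bad = "E0 \<union> E1 \<union> E2 \<union> Gs"
  have bad_sets: "?bad \<in> sets Q" using E0_sets E1_sets E2_sets Gs_sets by auto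
  have "measure Q ?bad \<le> measure Q E0 + measure Q E1 + measure Q E2 + measure Q Gs"
    using E0_sets E1_sets E2_sets Gs_sets
    by (intro order_trans[OF measure_Un_le] add_mono order_refl) auto
  also have "\<dots> \<le> 0 + 2 / n + 1 / n + 1 / n"
    using p0 p1 p2 pGs by linarith
  also have "\<dots> = 4 / n" by simp
  also have "\<dots> \<le> 5 / n" by (intro divide_right_mono) auto
  finally have bad: "measure Q ?bad \<le> 5 / n" .
  show ?thesis
  proof (rule that[of "space Q - ?bad"])
    show "space Q - ?bad \<in> sets Q" using bad_sets by auto
    show "1 - 5 / real n \<le> measure Q (space Q - ?bad)"
      using bad bad_sets by (simp add: Q.prob_compl)
  next
    fix X i assume X: "X \<in> space Q - ?bad" and i: "i < m"
    have "X i \<in> space P" by simp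
    moreover have "X i \<notin> N" using X i by (auto simp: E0_def)
    ultimately show "admissible_path n A \<mu> (X i)" using N(1) by blast
  next
    fix X assume X: "X \<in> space Q - ?bad"
    then show "gram_error m X < (m * T * lam / 2)\<^sup>2" by (auto simp: E2_def z_def)
  next
    fix X u v assume X: "X \<in> space Q - ?bad" and uv: "u < n" "v < n"
    have tau: "(\<Sum>i<m. tau n (X i)) < K" using X by (auto simp: E1_def)
    \<comment> \<open>As the total length is below K, the compensator is at most its value at K; a
      gradient sum above the threshold would therefore put X into
      \<open>G u v \<sigma>\<close>.\<close>
    have *: "\<sigma> * (\<Sum>i<m. noise u v (X i)) \<le> sqrt (2 * K * L) / \<alpha>" if \<sigma>: "\<sigma> \<in> {1, -1}" for \<sigma> :: real
    proof (rule ccontr)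
      assume "\<not> \<sigma> * (\<Sum>i<m. noise u v (X i)) \<le> sqrt (2 * K * L) / \<alpha>"
      then have "l * (sqrt (2 * K * L) / \<alpha>) \<le> l * (\<sigma> * (\<Sum>i<m. noise u v (X i)))"
        using l0 by (intro mult_left_mono) auto
      moreover have "l\<^sup>2 / (2 * \<alpha>\<^sup>2) * (\<Sum>i<m. tau n (X i)) \<le> l\<^sup>2 / (2 * \<alpha>\<^sup>2) * K"
        using tau by (intro mult_left_mono) auto
      ultimately have "L \<le> l * (\<sigma> * (\<Sum>i<m. noise u v (X i))) - l\<^sup>2 / (2 * \<alpha>\<^sup>2) * (\<Sum>i<m. tau n (X i))"
        using l_eq by linarith
      also have "\<dots> = (\<Sum>i<m. l * (\<sigma> * noise u v (X i)) - l\<^sup>2 / (2 * \<alpha>\<^sup>2) * tau n (X i))"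
        by (simp only: sum_subtractf sum_distrib_left)
      finally have "X \<in> G u v \<sigma>" using X by (simp add: G_def)
      then have "X \<in> Gs" using uv \<sigma> by (auto simp: Gs_def I_def)
      then show False using X by auto
    qed
    from *[of 1] *[of "-1"]
    have "\<bar>\<Sum>i<m. noise u v (X i)\<bar> \<le> sqrt (2 * K * L) / \<alpha>" by (simp add: abs_le_iff)
    then show "\<bar>\<Sum>i<m. noise u v (X i)\<bar> \<le> sqrt (2 * (m * (log_scale / \<Phi>)) * ln (4 * real n ^ 3)) / \<alpha>"
      by (simp add: K_def L_def)
  qed
qed

end
text \<open>One event serves all minimisers simultaneously, so the bound needs no measurable
  dependence of the estimator on the observations.\<close>

lemma l1_penalized_voter_estimator:
  fixes n m :: nat and A :: "real mat" and p :: "real vec" and \<alpha> :: real and \<mu> :: "state pmf"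
    and P :: "(nat \<Rightarrow> state) measure" and Params :: "real mat set"
  defines "\<pi>min \<equiv> Min ((\<lambda>v. p $ v) ` {..<n})"
    and "T \<equiv> expected_consensus_time n P"
    and "lam \<equiv> lambda_min (correlation_mat n P)"
  defines "cn \<equiv> sqrt ((ln (1 / (2 * \<pi>min)) + ln (2 * real n ^ 3)) * ln (4 * real n ^ 3))"
  defines "reg \<equiv> 2 * sqrt 2 * (cn / (\<alpha> * sqrt (Phi n A p))) * sqrt (real m)"
  assumes n2: "2 \<le> n"
    and A: "stochastic_mat n A" "irreducible_mat n A" and stat: "stationary_vec n A p"
    and \<alpha>0: "0 < \<alpha>" and \<alpha>: "\<forall>(u, v) \<in> mat_support A. \<alpha> \<le> A $$ (u, v)"
    and \<mu>: "set_pmf \<mu> \<subseteq> states n" and law: "voter_law n A \<mu> P"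
    and Params: "\<forall>A\<in>Params. voter_parameter n A" "A \<in> Params"
    and Phi: "0 < Phi n A p" and lam: "0 < lam"
    and large: "96 * real n ^ 3 * (1 / \<pi>min) * (1 / ((Phi n A p * T)\<^sup>2 * lam\<^sup>2)) \<le> real m"
  shows "\<exists>E\<in>sets (\<Pi>\<^sub>M i\<in>{..<m}. P). 1 - 5 / real n \<le> measure (\<Pi>\<^sub>M i\<in>{..<m}. P) E
    \<and> (\<forall>X\<in>E. \<forall>Ah. is_arg_min (loss n m \<mu> reg X) (\<lambda>A. A \<in> Params) Ah \<longrightarrow>
          (frobenius_norm (Ah - A))\<^sup>2
            \<le> 288 * (real (card (mat_support A)) * cn\<^sup>2 / (\<alpha>\<^sup>2 * (Phi n A p * T)\<^sup>2 * lam\<^sup>2))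
                * Phi n A p * (1 / real m))"
proof (cases "5 \<le> n")
  case False
  \<comment> \<open>For n < 5 the required probability is negative and the empty event will
    do.\<close>
  then have "1 - 5 / real n \<le> 0" using n2 by (simp add: field_simps)
  then show ?thesis by (intro bexI[of _ "{}"]) auto
next
  case n5: True
  interpret prob_space P using law by (simp add: voter_law_def voter_process_def)
  interpret voter_model P n A \<mu> p
  proof
    show "sets P = sets (\<Pi>\<^sub>M t\<in>UNIV. count_space UNIV)"
      using law by (simp add: voter_law_def)
    show "distr P (count_space UNIV) (\<lambda>\<omega>. \<omega> 0) = measure_pmf \<mu>"
      using law by (simp add: voter_law_def voter_process_def)
    show "\<P>(\<omega> in P. \<omega> (Suc t) = y \<bar> \<forall>r\<le>t. \<omega> r = x r) = pmf (voter_step n A (x t)) y"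
      if "\<P>(\<omega> in P. \<forall>r\<le>t. \<omega> r = x r) > 0" for t x y
      using law that by (simp add: voter_law_def voter_process_def)
  qed (use assms in auto)
  have pmin: "\<pi>min = pmin" by (simp add: \<pi>min_def pmin_def)
  have T: "0 < T" using expected_consensus_time_ge_1 by (simp add: T_def)
  have "0 < 96 * real n ^ 3 * (1 / \<pi>min) * (1 / ((\<Phi> * T)\<^sup>2 * lam\<^sup>2))"
    using n2 Phi T lam pmin_pos pmin by simp
  then have m: "0 < m" using large by linarith
  have n3: "1 \<le> real n ^ 3" using n2 by (intro one_le_power) auto
  have scale0: "0 \<le> log_scale"
    unfolding log_scale_def using n3 B_ge by (intro add_nonneg_nonneg) auto
  have L0: "0 \<le> ln (4 * real n ^ 3)" using n3 by (intro ln_ge_zero) linarith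
  have cn_eq: "cn = sqrt (log_scale * ln (4 * real n ^ 3))"
    by (simp add: cn_def log_scale_def B_def pmin)
  have cn0: "0 \<le> cn" unfolding cn_eq using scale0 L0 by simp
  have reg0: "0 \<le> reg" using cn0 \<alpha>0 Phi by (simp add: reg_def)
  \<comment> \<open>The regularization parameter is exactly twice the noise level of
    \<open>good_event\<close>, as the lasso argument demands.\<close>
  have reg_half: "sqrt (2 * (m * (log_scale / \<Phi>)) * ln (4 * real n ^ 3)) / \<alpha> = reg / 2"
    unfolding reg_def cn_eq by (simp add: real_sqrt_mult real_sqrt_divide mult_ac)
  have reg2: "reg\<^sup>2 = 8 * cn\<^sup>2 * m / (\<alpha>\<^sup>2 * \<Phi>)"
    using Phi by (simp add: reg_def power_mult_distrib power_divide)
  have \<alpha>': "\<alpha> \<le> A $$ (u, v)" if "u < n" "v < n" "A $$ (u, v) \<noteq> 0" for u v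
    using \<alpha> that carrier_A by (auto simp: mat_support_def)
  obtain E where E: "E \<in> sets (\<Pi>\<^sub>M i\<in>{..<m}. P)" "1 - 5 / real n \<le> measure (\<Pi>\<^sub>M i\<in>{..<m}. P) E"
    and adm: "\<And>X i. X \<in> E \<Longrightarrow> i < m \<Longrightarrow> admissible_path n A \<mu> (X i)"
    and noise: "\<And>X u v. X \<in> E \<Longrightarrow> u < n \<Longrightarrow> v < n \<Longrightarrow> \<bar>\<Sum>i<m. noise u v (X i)\<bar> \<le> reg / 2"
    and err: "\<And>X. X \<in> E \<Longrightarrow> gram_error m X < (m * T * lam / 2)\<^sup>2"
    using good_event[OF n5 m \<alpha>0 \<alpha>' lam large[unfolded pmin] T] unfolding reg_half by blast
  have bound: "(frobenius_norm (Ah - A))\<^sup>2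
            \<le> 288 * (real (card (mat_support A)) * cn\<^sup>2 / (\<alpha>\<^sup>2 * (\<Phi> * T)\<^sup>2 * lam\<^sup>2))
                * \<Phi> * (1 / real m)"
    if X: "X \<in> E" and Ah: "is_arg_min (loss n m \<mu> reg X) (\<lambda>A. A \<in> Params) Ah" for X Ah
  proof -
    have "voter_parameter n Ah" "\<not> loss n m \<mu> reg X A < loss n m \<mu> reg X Ah"
      using Ah Params by (auto simp: is_arg_min_def)
    with penalized_estimator_error[OF adm[OF X] noise[OF X] err[OF X, unfolded T_def lam_def] lam[unfolded lam_def] m reg0]
    have "(frobenius_norm (Ah - A))\<^sup>2 \<le> 36 * reg\<^sup>2 * real (card (mat_support A)) / (m * T * lam)\<^sup>2"
      by (simp add: T_def lam_def)
    \<comment> \<open>288 = 36 * 8; the single 1/\<Phi> in \<open>reg2\<close> appears as \<Phi> /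
      \<Phi>^2, and m / m^2 leaves 1/m.\<close>
    also have "\<dots> = 288 * (real (card (mat_support A)) * cn\<^sup>2 / (\<alpha>\<^sup>2 * (\<Phi> * T)\<^sup>2 * lam\<^sup>2))
                * \<Phi> * (1 / real m)"
      unfolding reg2 using m Phi T lam \<alpha>0 by (simp add: field_simps power2_eq_square)
    finally show ?thesis .
  qed
  show ?thesis using E bound by blast
qed

theorem theorem4p2:
  shows "\<exists>c>0. \<exists>c1>0. \<exists>c2>0.
    \<forall>(n::nat) (m::nat) (Astar::real mat) (\<pi>::real vec) (\<alpha>::real) (\<mu>::state pmf)
      (P::(nat \<Rightarrow> state) measure) (Params::real mat set).
      let s = real (card (mat_support Astar));
          \<pi>min = Min ((\<lambda>v. \<pi> $ v) ` {..<n});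
          \<Phi> = Phi n Astar \<pi>;
          T = expected_consensus_time n P;
          lam = lambda_min (correlation_mat n P);
          cn = sqrt ((ln (1 / (2 * \<pi>min)) + ln (2 * real n ^ 3)) * ln (4 * real n ^ 3));
          reg = 2 * sqrt 2 * (cn / (\<alpha> * sqrt \<Phi>)) * sqrt (real m);
          a = s * real n * ((ln (1 / (2 * \<pi>min)) + ln (real n)) / ((\<Phi> * T) * lam));
          Q = (\<Pi>\<^sub>M i\<in>{..<m}. P)
      in n \<ge> 2
         \<and> stochastic_mat n Astar \<and> irreducible_mat n Astar \<and> aperiodic_mat n Astar
         \<and> stationary_vec n Astar \<pi>
         \<and> 0 < \<alpha> \<and> (\<forall>(u, v) \<in> mat_support Astar. \<alpha> \<le> Astar $$ (u, v))
         \<and> set_pmf \<mu> \<subseteq> states n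
         \<and> voter_law n Astar \<mu> P
         \<and> (\<forall>A\<in>Params. voter_parameter n A) \<and> Astar \<in> Params
         \<and> 0 < \<Phi> \<and> 0 < lam
         \<and> real m \<ge> c1 * s\<^sup>2 * ((ln (1 / (2 * \<pi>min)) * (a + 1) * ln (real n)
                                  + (a + 1)\<^sup>2 * (ln (real n))\<^sup>2) / (\<Phi> * T\<^sup>2 * lam\<^sup>2))
         \<and> real m \<ge> c2 * real n ^ 3 * (1 / \<pi>min) * (1 / ((\<Phi> * T)\<^sup>2 * lam\<^sup>2))
         \<longrightarrow> (\<exists>E\<in>sets Q. measure Q E \<ge> 1 - 5 / real n
               \<and> (\<forall>X\<in>E. \<forall>Ahat. is_arg_min (loss n m \<mu> reg X) (\<lambda>A. A \<in> Params) Ahat \<longrightarrow>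
                    (frobenius_norm (Ahat - Astar))\<^sup>2
                      \<le> c * (s * cn\<^sup>2 / (\<alpha>\<^sup>2 * (\<Phi> * T)\<^sup>2 * lam\<^sup>2)) * \<Phi> * (1 / real m)))"
  unfolding Let_def
  by (intro exI[of _ "288::real"] exI[of _ "1::real"] exI[of _ "96::real"] conjI allI impI,
      simp_all only: zero_less_numeral zero_less_one)
     (elim conjE, rule l1_penalized_voter_estimator; assumption)

end
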